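(* Consider the Gaussian Bayesian spanning forest model with known number of clusters $K_{0,n}$ and oracle partition described in the context, with data in $\mathbb R^{p_n}$ and $f^{(n)}_{st}=\zeta(\sigma_n)\exp\{-\|y_s-y_t\|_2^2/(2\sigma_n^2)\}$, where $\zeta(\sigma)=(\sqrt{2\pi}\sigma)^{-p_n}$ and $\sigma_n>0$. For each $n$, suppose $y_1,\dots,y_n$ are independent with $y_i\sim \mathrm N(\mu_k,\Sigma_k)$ whenever $i\in V_k^{0,n}$, where $\mu_k$ and the positive definite $\Sigma_k$ may depend on $n$. Set $\Lambda_{\max}=\max_{k\in[K_{0,n}]}\lambda_{\max}(\Sigma_k)$ (largest eigenvalue), $D_{\mu,\min}=\min_{k\ne\ell;\,k,\ell\in[K_{0,n}]}\|\mu_k-\mu_\ell\|_2$ and $\mathrm{SNR}=D_{\mu,\min}/\sqrt{\Lambda_{\max}}$. Assume: (A1) there exist constants $C_1,C_2>0$ (not depending on $n$ or on the data) such that for all sufficiently large $n$, $C_1\delta_n\le \min_{i\in[n]} r_n(y_i)\le\max_{i\in[n]} r_n(y_i)\le C_2\delta_n$; (A2) $K_{0,n}=o(\sqrt n)$; (A3) $\mathrm{SNR}/\sqrt{p_n\vee\log n}\to\infty$ as $n\to\infty$; (A4) $\sigma_n^2=o\Big(\dfrac{D_{\mu,\min}^2}{n\log(K_{0,n}+1)}\wedge\Lambda_{\max}\Big)$. Then there exist constants $c,C>0$ independent of $n$ such that for all sufficiently large $n$ $$\mathbb E_{P_0^{(n)}}\big[\mathbb E(d_H(\mathcal V_n,(V_1^{0,n},\dots,V_{K_{0,n}}^{0,n}))\mid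 y^{(n)})\big]\le C\exp(-c\cdot\mathrm{SNR}^2),$$ where $P_0^{(n)}$ is the law of $y^{(n)}=(y_1,\dots,y_n)$.
   Context: Oracle. $(V_1^0,V_2^0,\dots)$ is a fixed partition of the positive integers into disjoint sets. For each $n$, $[n]=\{1,\dots,n\}$, $V_k^{0,n}=V_k^0\cap[n]$, and $K_{0,n}$ is the number of nonempty sets among these, labelled $k=1,\dots,K_{0,n}$. Data for different $n$ form a triangular array and need not be nested. When $K_{0,n}=1$, $D_{\mu,\min}=+\infty$. BSF model with known number of clusters. For each $n$ there are weights $f^{(n)}_{st}$ as in the claim ($s\ne t$), a positive root kernel $r_n$, and a number $\delta_n>0$. For nonempty $V\subset[n]$, $L_V$ is the graph Laplacian on $V$ with edge weights $f^{(n)}_{st}$ (off-diagonal entries $-f^{(n)}_{st}$, diagonal entries $\sum_{t\in V,t\neq s}f^{(n)}_{st}$), and $|L_V[1]|$ is the determinant of $L_V$ with first row and column removed (equal to $1$ if $|V|=1$). With $K_{0,n}$ known, the posterior of $\mathcal V_n$ is supported on ordered partitions $(V_1,\dots,V_{K_{0,n}})$ of $[n]$ into $K_{0,n}$ nonempty sets, with probability proportional to $\prod_{k=1}^{K_{0,n}}\big[\big(\sum_{i\in V_k}r_n(y_i)\big)|L_{V_k}[1]|\big]$. The inner expectation $\mathbb E(\cdot\mid y^{(n)})$ is with respect to this posterior. Hamming distance. For two partitions of $[n]$ into $K_{0,n}$ blocks with label vectors $z^1,z^2\in[K_{0,n}]^n$, $d_H=\min_\psi\sum_{i=1}^n\mathbf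 1\{\psi(z^1_i)\ne z^2_i\}$, the minimum being over bijections $\psi$ of $[K_{0,n}]$. *)

theory Defs
  imports
    "HOL-Probability.Probability"
    "HOL-Library.Landau_Symbols"
    "Jordan_Normal_Form.Char_Poly"
    "Jordan_Normal_Form.Gauss_Jordan_Elimination"
begin

(* Since the dimension p varies with the sample size, a point of R^p is a function nat => real
   whose coordinates are its values on {..<p}; data points live in the measurable space
   PiM {..<p} (%_. borel).  Matrices are the dimension-free matrices of Jordan_Normal_Form;
   vectors are turned into coordinate vectors by Matrix.vec p. *)

definition euclid_dist :: "nat \<Rightarrow> (nat \<Rightarrow> real) \<Rightarrow> (nat \<Rightarrow> real) \<Rightarrow> real" where
  "euclid_dist p x y = L2_set (\<lambda>j. x j - y j) {..<p}"

definition positive_definite :: "nat \<Rightarrow> real mat \<Rightarrow> bool" where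
  "positive_definite p A \<longleftrightarrow>
     A \<in> carrier_mat p p \<and> transpose_mat A = A \<and>
     (\<forall>v \<in> carrier_vec p. v \<noteq> 0\<^sub>v p \<longrightarrow> scalar_prod v (A *\<^sub>v v) > 0)"

definition lambda_max :: "real mat \<Rightarrow> real" where
  "lambda_max A = Max {l. eigenvalue A l}"

definition mvn_density ::
  "nat \<Rightarrow> (nat \<Rightarrow> real) \<Rightarrow> real mat \<Rightarrow> (nat \<Rightarrow> real) \<Rightarrow> real" where
  "mvn_density p \<mu> A x =
     (let v = Matrix.vec p (\<lambda>j. x j - \<mu> j)
      in exp (- (scalar_prod v (the (mat_inverse A) *\<^sub>v v)) / 2)
         / sqrt ((2 * pi) ^ p * Determinant.det A))"

definition active_blocks :: "(nat \<Rightarrow> nat set) \<Rightarrow> nat \<Rightarrow> nat set" where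
  "active_blocks V0 n = {j \<in> {1..}. V0 j \<inter> {1..n} \<noteq> {}}"

definition num_blocks :: "(nat \<Rightarrow> nat set) \<Rightarrow> nat \<Rightarrow> nat" where
  "num_blocks V0 n = card (active_blocks V0 n)"

(* e n maps the label k in {1..K_{0,n}} to the index in the original sequence (V_1^0, V_2^0, ...)
   of the block carrying that label at sample size n. *)
definition oracle_block ::
  "(nat \<Rightarrow> nat set) \<Rightarrow> (nat \<Rightarrow> nat \<Rightarrow> nat) \<Rightarrow> nat \<Rightarrow> nat \<Rightarrow> nat set" where
  "oracle_block V0 e n k = V0 (e n k) \<inter> {1..n}"

definition Lambda_max :: "nat \<Rightarrow> (nat \<Rightarrow> real mat) \<Rightarrow> real" where
  "Lambda_max K A = Max ((\<lambda>k. lambda_max (A k)) ` {1..K})"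

(* The infimum over the empty index set is infinity, so that D = infinity when K = 1. *)
definition D_mu_min :: "nat \<Rightarrow> nat \<Rightarrow> (nat \<Rightarrow> nat \<Rightarrow> real) \<Rightarrow> ereal" where
  "D_mu_min p K \<mu> =
     (INF (k, l) \<in> {(k, l). k \<in> {1..K} \<and> l \<in> {1..K} \<and> k \<noteq> l}.
        ereal (euclid_dist p (\<mu> k) (\<mu> l)))"

definition SNR :: "nat \<Rightarrow> nat \<Rightarrow> (nat \<Rightarrow> nat \<Rightarrow> real) \<Rightarrow> (nat \<Rightarrow> real mat) \<Rightarrow> ereal" where
  "SNR p K \<mu> A = D_mu_min p K \<mu> / ereal (sqrt (Lambda_max K A))"

(* exp (-x), with the convention exp (-infinity) = 0; it is only applied to x >= 0. *)
definition exp_minus :: "ereal \<Rightarrow> real" where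
  "exp_minus x = (if x = \<infinity> then 0 else exp (- real_of_ereal x))"

definition gaussian_weight ::
  "nat \<Rightarrow> real \<Rightarrow> (nat \<Rightarrow> real) \<Rightarrow> (nat \<Rightarrow> real) \<Rightarrow> real" where
  "gaussian_weight p \<sigma> x y =
     inverse ((sqrt (2 * pi) * \<sigma>) ^ p) * exp (- (euclid_dist p x y)\<^sup>2 / (2 * \<sigma>\<^sup>2))"

(* Rows and columns follow the increasing enumeration of V. *)
definition laplacian :: "(nat \<Rightarrow> nat \<Rightarrow> real) \<Rightarrow> nat set \<Rightarrow> real mat" where
  "laplacian f V =
     (let xs = sorted_list_of_set V in
      Matrix.mat (card V) (card V) (\<lambda>(a, b).
        if a = b then (\<Sum>t \<in> V - {xs ! a}. f (xs ! a) t) else - f (xs ! a) (xs ! b)))"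

definition laplacian_minor :: "(nat \<Rightarrow> nat \<Rightarrow> real) \<Rightarrow> nat set \<Rightarrow> real" where
  "laplacian_minor f V = Determinant.det (mat_delete (laplacian f V) 0 0)"

definition ordered_partitions :: "nat \<Rightarrow> nat \<Rightarrow> (nat \<Rightarrow> nat set) set" where
  "ordered_partitions n K =
     {V \<in> {1..K} \<rightarrow>\<^sub>E Pow {1..n}.
        (\<forall>k \<in> {1..K}. V k \<noteq> {}) \<and> disjoint_family_on V {1..K} \<and> (\<Union>k \<in> {1..K}. V k) = {1..n}}"

definition bsf_weight ::
  "nat \<Rightarrow> ((nat \<Rightarrow> real) \<Rightarrow> real) \<Rightarrow> nat \<Rightarrow> real \<Rightarrow> (nat \<Rightarrow> nat \<Rightarrow> real) \<Rightarrow> (nat \<Rightarrow> nat set) \<Rightarrow> real" where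
  "bsf_weight K r p \<sigma> y V =
     (\<Prod>k \<in> {1..K}. (\<Sum>i \<in> V k. r (y i)) *
        laplacian_minor (\<lambda>s t. gaussian_weight p \<sigma> (y s) (y t)) (V k))"

definition bsf_posterior ::
  "nat \<Rightarrow> nat \<Rightarrow> ((nat \<Rightarrow> real) \<Rightarrow> real) \<Rightarrow> nat \<Rightarrow> real \<Rightarrow> (nat \<Rightarrow> nat \<Rightarrow> real) \<Rightarrow> (nat \<Rightarrow> nat set) \<Rightarrow> real"
  where
  "bsf_posterior n K r p \<sigma> y V =
     bsf_weight K r p \<sigma> y V / (\<Sum>W \<in> ordered_partitions n K. bsf_weight K r p \<sigma> y W)"

definition posterior_expectation ::
  "nat \<Rightarrow> nat \<Rightarrow> ((nat \<Rightarrow> real) \<Rightarrow> real) \<Rightarrow> nat \<Rightarrow> real \<Rightarrow> (nat \<Rightarrow> nat \<Rightarrow> real) \<Rightarrow>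
   ((nat \<Rightarrow> nat set) \<Rightarrow> real) \<Rightarrow> real" where
  "posterior_expectation n K r p \<sigma> y g =
     (\<Sum>V \<in> ordered_partitions n K. bsf_posterior n K r p \<sigma> y V * g V)"

definition block_label :: "nat \<Rightarrow> (nat \<Rightarrow> nat set) \<Rightarrow> nat \<Rightarrow> nat" where
  "block_label K V i = (THE k. k \<in> {1..K} \<and> i \<in> V k)"

definition hamming_dist :: "nat \<Rightarrow> nat \<Rightarrow> (nat \<Rightarrow> nat set) \<Rightarrow> (nat \<Rightarrow> nat set) \<Rightarrow> nat" where
  "hamming_dist n K U V =
     Min {card {i \<in> {1..n}. \<psi> (block_label K U i) \<noteq> block_label K V i} | \<psi>.
            bij_betw \<psi> {1..K} {1..K}}"

end

(* The posterior weight of a partition is, up to the factors from the root kernel, a product of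
   Laplacian minors.  If a partition puts two points of different oracle blocks together, then
   deleting its edges between oracle blocks leaves a Laplacian of rank smaller than n - K, so the
   corresponding minor vanishes.  Putting the deleted edges back costs at most a relative factor
   (1 + n eta)^n - 1, where eta is the ratio of the largest weight between oracle blocks to the
   smallest weight inside one.  All this is done with determinants; no spanning trees are needed.

   When every observation lies within D/8 of its mean, eta is at most exp(-D^2/(4 sigma^2)), and
   (A2) and (A4) make this beat the K^n partitions, the factors from the root kernel and SNR^2.
   On the complement, the Hamming distance is at most n, and the probability is at most
   n 2^(p/2) exp(-SNR^2/256), where (A3) absorbs the prefactors. *)

theory Submission
  imports Defs "HOL-Real_Asymp.Real_Asymp"
begin

section \<open>Determinants of pinned Laplacians\<close>

text \<open>A product of tree determinants over the blocks of a partition is one principal minor of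
  a block-diagonal Laplacian, with one root per block removed. All partitions into K blocks thus
  become minors of matrices on the same vertex set. The obstacle is that turning crossing edges into
  pins and expanding in the pins shrinks the index set Q. The oracle estimate is therefore proved
  for every Q at once: the minor on Q is at most T * \<delta>^(|Q| - (n - K)), with T the oracle
  product and \<delta> the smallest weight inside a block. Signs are harmless because a pinned
  determinant is affine in each pin, with a pinned determinant on fewer vertices as coefficient;
  induction along this expansion gives positivity, monotonicity and factorisation. Constants:
  deviations of D/8 give distances at most D/4 inside and at least 3D/4 across blocks, and (9/16 -
  1/16)/2 = 1/4. Half of the Gaussian exponent at radius D/8 is SNR^2/256; half of that pays for the
  prefactors, which leaves 1/512.\<close>

text \<open>Laplacian of the (possibly directed) weighted graph on \<open>xs\<close>, where \<open>h s\<close> is the weight of an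
  additional edge from \<open>s\<close> to a removed root vertex. Deleting a row and the corresponding column
  of such a matrix gives again one.\<close>

definition pinned_mat :: "(nat \<Rightarrow> nat \<Rightarrow> real) \<Rightarrow> (nat \<Rightarrow> real) \<Rightarrow> nat list \<Rightarrow> real mat" where
  "pinned_mat f h xs = Matrix.mat (length xs) (length xs) (\<lambda>(a, b).
     if a = b then h (xs ! a) + (\<Sum>t \<in> set xs - {xs ! a}. f (xs ! a) t) else - f (xs ! a) (xs ! b))"

definition pinned_det :: "(nat \<Rightarrow> nat \<Rightarrow> real) \<Rightarrow> (nat \<Rightarrow> real) \<Rightarrow> nat set \<Rightarrow> real" where
  "pinned_det f h Q = Determinant.det (pinned_mat f h (sorted_list_of_set Q))"

lemma pinned_mat_carrier: "pinned_mat f h xs \<in> carrier_mat (length xs) (length xs)"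
  by (simp add: pinned_mat_def)

lemma remove1_nth:
  assumes "distinct xs" "i < length xs"
  shows "remove1 (xs ! i) xs = take i xs @ drop (Suc i) xs"
proof -
  have "xs = take i xs @ xs ! i # drop (Suc i) xs"
    using assms(2) by (rule id_take_nth_drop)
  moreover have "xs ! i \<notin> set (take i xs)"
    using assms by (metis calculation distinct_append not_distinct_conv_prefix)
  ultimately show ?thesis
    by (metis remove1.simps(2) remove1_append)
qed

lemma nth_remove1_nth:
  assumes "distinct xs" "i < length xs" "a < length xs - 1"
  shows "remove1 (xs ! i) xs ! a = xs ! (if a < i then a else Suc a)"
  using assms by (auto simp: remove1_nth nth_append min_def)

text \<open>The diagonal entries still count the edge to the deleted vertex, so this edge has to
  reappear as a pin: deleting a vertex merges it with the root.\<close>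

lemma mat_delete_pinned_mat:
  assumes d: "distinct xs" and i: "i < length xs"
  shows "mat_delete (pinned_mat f h xs) i i =
    pinned_mat f (\<lambda>s. h s + f s (xs ! i)) (remove1 (xs ! i) xs)" (is "?A = ?B")
proof (rule eq_matI)
  let ?ys = "remove1 (xs ! i) xs"
  have len: "length ?ys = length xs - 1" using i by (simp add: length_remove1)
  show "dim_row ?A = dim_row ?B" "dim_col ?A = dim_col ?B"
    by (auto simp: pinned_mat_def len mat_delete_def)
  fix a b assume ab: "a < dim_row ?B" "b < dim_col ?B"
  then have a: "a < length xs - 1" and b: "b < length xs - 1" by (auto simp: pinned_mat_def len)
  define sk where "sk = (\<lambda>a. if a < i then a else Suc a)"
  have nth: "?ys ! a = xs ! sk a" "?ys ! b = xs ! sk b"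
    using nth_remove1_nth[OF d i a] nth_remove1_nth[OF d i b] by (simp_all add: sk_def)
  have sk: "sk a < length xs" "sk b < length xs" "sk a \<noteq> i" "sk a = sk b \<longleftrightarrow> a = b"
    using a b by (auto simp: sk_def)
  have ne: "xs ! sk a \<noteq> xs ! i" using sk d i by (simp add: nth_eq_iff_index_eq)
  have "set xs - {xs ! sk a} = insert (xs ! i) (set ?ys - {xs ! sk a})"
    using d ne i by auto
  then have s: "(\<Sum>t \<in> set xs - {xs ! sk a}. f (xs ! sk a) t) =
      f (xs ! sk a) (xs ! i) + (\<Sum>t \<in> set ?ys - {xs ! sk a}. f (xs ! sk a) t)"
    using d by simp
  have "?A $$ (a, b) = pinned_mat f h xs $$ (sk a, sk b)"
    using a b by (simp add: mat_delete_def pinned_mat_def sk_def)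
  also have "\<dots> = ?B $$ (a, b)"
    using a b sk s nth
    by (auto simp: pinned_mat_def len)
  finally show "?A $$ (a, b) = ?B $$ (a, b)" .
qed

lemma pinned_det_cong:
  assumes "finite Q" "\<And>s t. s \<in> Q \<Longrightarrow> t \<in> Q \<Longrightarrow> s \<noteq> t \<Longrightarrow> f s t = f' s t" "\<And>s. s \<in> Q \<Longrightarrow> h s = h' s"
  shows "pinned_det f h Q = pinned_det f' h' Q"
proof -
  let ?xs = "sorted_list_of_set Q"
  have "set ?xs = Q" "distinct ?xs" using assms(1) by auto
  then have "?xs ! a \<in> Q" if "a < length ?xs" for a using that nth_mem by blast
  then have "pinned_mat f h ?xs = pinned_mat f' h' ?xs"
    unfolding pinned_mat_def using assms
    by (intro cong_mat) (auto intro!: assms sum.cong simp: nth_eq_iff_index_eq)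
  then show ?thesis by (simp add: pinned_det_def)
qed

lemma pinned_det_empty [simp]: "pinned_det f h {} = 1"
  unfolding pinned_det_def using pinned_mat_carrier[of f h "[]"] by simp

text \<open>Without pins every row sums to 0, so the constant vector lies in the kernel.\<close>

lemma pinned_det_unpinned:
  assumes Q: "finite Q" "Q \<noteq> {}" and h: "\<And>s. s \<in> Q \<Longrightarrow> h s = 0"
  shows "pinned_det f h Q = 0"
proof -
  let ?xs = "sorted_list_of_set Q" and ?n = "card Q"
  let ?A = "pinned_mat f h ?xs" and ?v = "Matrix.vec (card Q) (\<lambda>_. 1 :: real)"
  have A: "?A \<in> carrier_mat ?n ?n" using pinned_mat_carrier[of f h ?xs] by simp
  have n: "?n > 0" using Q by (simp add: card_gt_0_iff)
  have set: "set ?xs = Q" "distinct ?xs" "length ?xs = ?n" using Q by auto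
  have "?A *\<^sub>v ?v = 0\<^sub>v ?n"
  proof (rule eq_vecI)
    fix a assume "a < dim_vec (0\<^sub>v ?n)"
    then have a: "a < ?n" by simp
    have bij: "bij_betw (\<lambda>b. ?xs ! b) {0..<?n} Q"
      using set bij_betw_nth[of ?xs "{0..<?n}" Q] by (simp add: lessThan_atLeast0)
    have "(?A *\<^sub>v ?v) $ a = (\<Sum>b = 0..<?n. ?A $$ (a, b))"
      using a A set by (simp add: mult_mat_vec_def scalar_prod_def)
    also have "\<dots> = (\<Sum>b = 0..<?n. if ?xs ! b = ?xs ! a then (\<Sum>t \<in> Q - {?xs ! a}. f (?xs ! a) t)
        else - f (?xs ! a) (?xs ! b))"
      using a set nth_mem[of a ?xs] h
      by (intro sum.cong) (auto simp: pinned_mat_def nth_eq_iff_index_eq)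
    also have "\<dots> = (\<Sum>u \<in> Q. if u = ?xs ! a then (\<Sum>t \<in> Q - {?xs ! a}. f (?xs ! a) t)
        else - f (?xs ! a) u)"
      using sum.reindex_bij_betw[OF bij] .
    also have "\<dots> = (\<Sum>t \<in> Q - {?xs ! a}. f (?xs ! a) t) + (\<Sum>u \<in> Q - {?xs ! a}. - f (?xs ! a) u)"
      using a set nth_mem[of a ?xs] Q by (subst sum.remove[of Q "?xs ! a"]) (auto intro!: sum.cong)
    also have "\<dots> = 0" by (simp add: sum_negf)
    finally show "(?A *\<^sub>v ?v) $ a = 0\<^sub>v ?n $ a" using a by simp
  qed (use A in simp)
  moreover have "?v \<noteq> 0\<^sub>v ?n"
  proof
    assume "?v = 0\<^sub>v ?n"
    then have "?v $ 0 = 0\<^sub>v ?n $ 0" by simp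
    then show False using n by simp
  qed
  ultimately have "Determinant.det ?A = 0"
    unfolding det_0_iff_vec_prod_zero_field[OF A] by (intro exI[of _ ?v]) auto
  then show ?thesis by (simp add: pinned_det_def)
qed

text \<open>The pin of \<open>q\<close> occurs in one diagonal entry only, and the determinant is
  affine in that entry. The coefficient is the minor without \<open>q\<close>, where
  \<open>q\<close> has become a root.\<close>

lemma pinned_det_add_pin:
  assumes Q: "finite Q" "q \<in> Q"
  shows "pinned_det f (h(q := h q + c)) Q =
    pinned_det f h Q + c * pinned_det f (\<lambda>s. h s + f s q) (Q - {q})"
proof -
  let ?xs = "sorted_list_of_set Q" and ?n = "card Q" and ?h = "h(q := h q + c)"
  let ?A = "pinned_mat f ?h ?xs" and ?B = "pinned_mat f h ?xs"
  have set: "set ?xs = Q" "distinct ?xs" "length ?xs = ?n" using Q by auto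
  obtain i where i: "i < ?n" "?xs ! i = q" using Q(2) set by (metis in_set_conv_nth)
  have A: "?A \<in> carrier_mat ?n ?n" and B: "?B \<in> carrier_mat ?n ?n"
    using pinned_mat_carrier[of _ _ ?xs] set by auto
  have ent: "?A $$ (i, j) = ?B $$ (i, j) + (if j = i then c else 0)" if "j < ?n" for j
    using that i set by (auto simp: pinned_mat_def)
  have other: "?A $$ (a, j) = ?B $$ (a, j)" if "a < ?n" "j < ?n" "a \<noteq> i" for a j
    using that i set nth_eq_iff_index_eq[of ?xs a i] by (auto simp: pinned_mat_def)
  \<comment> \<open>The cofactors along row \<open>i\<close> do not see row \<open>i\<close>, which
    is the only row where the matrices differ.\<close>
  have del: "mat_delete ?A i j = mat_delete ?B i j" for j
    using A B other by (intro eq_matI) (auto simp: mat_delete_def)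
  have cof: "cofactor ?A i j = cofactor ?B i j" for j
    by (simp add: cofactor_def del)
  have "Determinant.det ?A = (\<Sum>j<?n. ?A $$ (i, j) * cofactor ?A i j)"
    using laplace_expansion_row[OF A i(1)] .
  also have "\<dots> = (\<Sum>j<?n. ?B $$ (i, j) * cofactor ?B i j + (if j = i then c else 0) * cofactor ?B i j)"
    unfolding cof by (intro sum.cong refl) (simp only: ent lessThan_iff distrib_right)
  also have "\<dots> = Determinant.det ?B + c * cofactor ?B i i"
    using i by (simp add: sum.distrib laplace_expansion_row[OF B i(1)] if_distrib[of "\<lambda>x. x * _"] cong: if_cong)
  also have "cofactor ?B i i = Determinant.det (mat_delete ?B i i)"
    by (simp add: cofactor_def)
  also have "mat_delete ?B i i = pinned_mat f (\<lambda>s. h s + f s q) (sorted_list_of_set (Q - {q}))"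
    using mat_delete_pinned_mat[of ?xs i f h] i set Q by (simp add: sorted_list_of_set_remove)
  finally show ?thesis unfolding pinned_det_def .
qed

text \<open>The enumeration of \<open>V\<close> is increasing, so the deleted first row belongs to
  \<open>Min V\<close>, which becomes the root.\<close>

lemma laplacian_minor_eq:
  assumes V: "finite V" "V \<noteq> {}"
  shows "laplacian_minor f V = pinned_det f (\<lambda>s. f s (Min V)) (V - {Min V})"
proof -
  let ?xs = "sorted_list_of_set V"
  have "laplacian f V = pinned_mat f (\<lambda>_. 0) ?xs"
    using V by (simp add: laplacian_def pinned_mat_def Let_def cong: if_cong)
  moreover have "?xs ! 0 = Min V" using V
    by (metis Min_in nth_Cons_0 sorted_list_of_set_nonempty)
  moreover have "0 < length ?xs" using V by (simp add: card_gt_0_iff)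
  ultimately show ?thesis
    using mat_delete_pinned_mat[of ?xs 0 f "\<lambda>_. 0"] V
    by (simp add: laplacian_minor_def pinned_det_def sorted_list_of_set_remove)
qed

text \<open>The recursion behind the inductions below: either \<open>q\<close> is cut off from the
  root, or it is tied to the root and becomes a root itself. \<open>h0\<close> is given by an
  equation so that it matches the case of the induction rule.\<close>

lemma pinned_det_expand:
  assumes Q: "finite Q" "q \<in> Q" and h0: "\<And>s. h0 s = (if s = q then 0 else h s)"
  shows "pinned_det f h Q =
    pinned_det f h0 Q + h q * pinned_det f (\<lambda>s. h s + f s q) (Q - {q})"
proof -
  have "pinned_det f (\<lambda>s. h0 s + f s q) (Q - {q}) = pinned_det f (\<lambda>s. h s + f s q) (Q - {q})"
    using Q by (intro pinned_det_cong) (auto simp: h0)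
  moreover have "h0(q := h0 q + h q) = h" by (auto simp: h0)
  ultimately show ?thesis
    using pinned_det_add_pin[OF Q, of f h0 "h q"] by simp
qed

section \<open>Induction over pins: positivity, monotonicity and factorisation\<close>

text \<open>Each step lowers either the number of vertices or, on the same vertices, the number of
  nonzero pins. Removing \<open>q\<close> changes the other pins, hence the hypothesis on
  \<open>Q - {q}\<close> is available for all pins.\<close>

lemma pinned_induct [consumes 1, case_names unpinned pinned]:
  fixes P :: "nat set \<Rightarrow> (nat \<Rightarrow> real) \<Rightarrow> bool"
  assumes "finite Q"
    and unpinned: "\<And>Q h. finite Q \<Longrightarrow> (\<forall>s\<in>Q. h s = 0) \<Longrightarrow> P Q h"
    and pinned: "\<And>Q h q h0. finite Q \<Longrightarrow> q \<in> Q \<Longrightarrow> (\<And>s. h0 s = (if s = q then 0 else h s)) \<Longrightarrow> P Q h0 \<Longrightarrow> (\<And>h'. P (Q - {q}) h') \<Longrightarrow> P Q h"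
  shows "P Q h"
  using assms(1)
proof (induction "card Q" arbitrary: Q h rule: less_induct)
  case outer: (less Q h)
  show ?case
  proof (induction "card {s \<in> Q. h s \<noteq> 0}" arbitrary: h rule: less_induct)
    case inner: (less h)
    show ?case
    proof (cases "\<forall>s\<in>Q. h s = 0")
      case False
      then obtain q where q: "q \<in> Q" "h q \<noteq> 0" by auto
      define h0 where "h0 s = (if s = q then 0 else h s)" for s
      have "{s \<in> Q. h0 s \<noteq> 0} \<subset> {s \<in> Q. h s \<noteq> 0}" using q by (auto simp: h0_def)
      then have "card {s \<in> Q. h0 s \<noteq> 0} < card {s \<in> Q. h s \<noteq> 0}"
        using outer.prems by (intro psubset_card_mono) auto

      then have "P Q h0" by (rule inner)
      moreover have "P (Q - {q}) h'" for h'
        using q outer.prems card_Diff1_less[of Q q] by (intro outer) auto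
      ultimately show ?thesis using pinned[OF _ q(1), of h0] outer.prems h0_def by blast
    qed (use unpinned outer.prems in blast)
  qed
qed

text \<open>Both terms of the expansion inherit nonnegativity. Combinatorially, this is the
  positivity of a weighted count of rooted forests.\<close>

lemma pinned_det_nonneg:
  assumes "finite Q" and f: "\<And>s t. 0 \<le> f s t" and h: "\<And>s. s \<in> Q \<Longrightarrow> 0 \<le> h s"
  shows "0 \<le> pinned_det f h Q"
proof -
  have "(\<forall>s\<in>Q. 0 \<le> h s) \<longrightarrow> 0 \<le> pinned_det f h Q"
    using assms(1)
  proof (induction Q h rule: pinned_induct)
    case (unpinned Q h)
    then show ?case by (cases "Q = {}") (auto simp: pinned_det_unpinned)
  next
    case (pinned Q h q h0)
    show ?case
    proof
      assume nn: "\<forall>s\<in>Q. 0 \<le> h s"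
      have "\<forall>s\<in>Q. 0 \<le> h0 s" using nn pinned.hyps by simp
      then have "0 \<le> pinned_det f h0 Q" using pinned.IH(1) by blast
      moreover have "0 \<le> pinned_det f (\<lambda>s. h s + f s q) (Q - {q})"
        using pinned.IH(2)[of "\<lambda>s. h s + f s q"] nn f by simp
      ultimately show "0 \<le> pinned_det f h Q"
        using nn pinned.hyps unfolding pinned_det_expand[OF pinned.hyps(1-3), of f] by simp
    qed
  qed
  then show ?thesis using h by blast
qed

text \<open>The induction runs over the larger pins \<open>h'\<close>: where these vanish, so do the
  smaller ones, and both determinants are equal.\<close>

lemma pinned_det_mono:
  assumes "finite Q" and f: "\<And>s t. 0 \<le> f s t" "\<And>s t. f s t \<le> f' s t"
    and h: "\<And>s. s \<in> Q \<Longrightarrow> 0 \<le> h s" "\<And>s. s \<in> Q \<Longrightarrow> h s \<le> h' s"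
  shows "pinned_det f h Q \<le> pinned_det f' h' Q"
proof -
  have "\<forall>h. (\<forall>s\<in>Q. 0 \<le> h s \<and> h s \<le> h' s) \<longrightarrow> pinned_det f h Q \<le> pinned_det f' h' Q"
    using assms(1)
  proof (induction Q h' rule: pinned_induct)
    case (unpinned Q h')
    show ?case
    proof (intro allI impI)
      fix h assume "\<forall>s\<in>Q. 0 \<le> h s \<and> h s \<le> h' s"
      then have "\<forall>s\<in>Q. h s = 0" using unpinned by fastforce
      then show "pinned_det f h Q \<le> pinned_det f' h' Q"
        using unpinned by (cases "Q = {}") (auto simp: pinned_det_unpinned)
    qed
  next
    case (pinned Q h' q h0)
    show ?case
    proof (intro allI impI)
      fix h assume hh: "\<forall>s\<in>Q. 0 \<le> h s \<and> h s \<le> h' s"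
      define h1 where "h1 s = (if s = q then 0 else h s)" for s
      have "\<forall>s\<in>Q. 0 \<le> h1 s \<and> h1 s \<le> h0 s" using hh pinned.hyps(3) by (simp add: h1_def)
      then have "pinned_det f h1 Q \<le> pinned_det f' h0 Q"
        using pinned.IH(1) by blast
      moreover have "pinned_det f (\<lambda>s. h s + f s q) (Q - {q}) \<le> pinned_det f' (\<lambda>s. h' s + f' s q) (Q - {q})"
      proof -
        have "\<forall>s\<in>Q - {q}. 0 \<le> h s + f s q \<and> h s + f s q \<le> h' s + f' s q"
          using hh f by (auto intro: add_mono)
        then show ?thesis by (rule pinned.IH(2)[THEN spec, THEN mp])
      qed
      moreover have "0 \<le> pinned_det f (\<lambda>s. h s + f s q) (Q - {q})"
        using pinned.hyps(1) hh f by (intro pinned_det_nonneg) simp_all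
      ultimately show "pinned_det f h Q \<le> pinned_det f' h' Q"
        unfolding pinned_det_expand[OF pinned.hyps(1,2) h1_def] pinned_det_expand[OF pinned.hyps(1-3)]
        using hh pinned.hyps(2) by (intro add_mono mult_mono) (auto intro: order_trans[of 0 "h q"])
    qed
  qed
  then show ?thesis using h by blast
qed

text \<open>In terms of forests oriented towards their roots: cut every edge coming from \<open>b\<close> and make its
  source a root.\<close>

lemma pinned_det_edges_to_pins:
  assumes "finite Q" and f: "\<And>s t. 0 \<le> f s t" and b: "\<And>s t. 0 \<le> b s t"
    and h: "\<And>s. s \<in> Q \<Longrightarrow> 0 \<le> h s"
  shows "pinned_det (\<lambda>s t. f s t + b s t) h Q \<le> pinned_det f (\<lambda>s. h s + (\<Sum>t\<in>Q - {s}. b s t)) Q"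
proof -
  have "(\<forall>s\<in>Q. 0 \<le> h s) \<longrightarrow>
    pinned_det (\<lambda>s t. f s t + b s t) h Q \<le> pinned_det f (\<lambda>s. h s + (\<Sum>t\<in>Q - {s}. b s t)) Q"
    using assms(1)
  proof (induction Q h rule: pinned_induct)
    case (unpinned Q h)
    show ?case
    proof (cases "Q = {}")
      case False
      then have "pinned_det (\<lambda>s t. f s t + b s t) h Q = 0"
        using unpinned by (auto simp: pinned_det_unpinned)
      moreover have "0 \<le> pinned_det f (\<lambda>s. h s + (\<Sum>t\<in>Q - {s}. b s t)) Q"
        using unpinned f b by (intro pinned_det_nonneg) (auto intro: sum_nonneg)
      ultimately show ?thesis by simp
    qed simp
  next
    case (pinned Q h q h0)
    show ?case
    proof
      assume hh: "\<forall>s\<in>Q. 0 \<le> h s"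
      let ?deg = "\<lambda>s. \<Sum>t\<in>Q - {s}. b s t"
      let ?h1 = "\<lambda>s. h0 s + ?deg s"
      have "pinned_det (\<lambda>s t. f s t + b s t) (\<lambda>s. h s + (f s q + b s q)) (Q - {q}) \<le>
          pinned_det f (\<lambda>s. h s + (f s q + b s q) + (\<Sum>t\<in>Q - {q} - {s}. b s t)) (Q - {q})"
        using pinned.IH(2) hh f b by simp
      \<comment> \<open>Removing \<open>q\<close> has already turned \<open>b s q\<close> into a
        pin. This is exactly the term of the sum over \<open>Q - {s}\<close> that the induction
        hypothesis on \<open>Q - {q}\<close> misses.\<close>
      also have "\<dots> = pinned_det f (\<lambda>s. ?h1 s + f s q) (Q - {q})"
      proof (intro pinned_det_cong)
        fix s assume s: "s \<in> Q - {q}"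
        then have "Q - {s} = insert q (Q - {q} - {s})" using pinned.hyps by auto
        then have "?deg s = b s q + (\<Sum>t\<in>Q - {q} - {s}. b s t)" using pinned.hyps by simp
        then show "h s + (f s q + b s q) + (\<Sum>t\<in>Q - {q} - {s}. b s t) = ?h1 s + f s q"
          using s pinned.hyps(3) by simp
      qed (use pinned.hyps in auto)
      finally have 2: "pinned_det (\<lambda>s t. f s t + b s t) (\<lambda>s. h s + (f s q + b s q)) (Q - {q}) \<le>
        pinned_det f (\<lambda>s. ?h1 s + f s q) (Q - {q})" .
      have "\<forall>s\<in>Q. 0 \<le> h0 s" using hh pinned.hyps(3) by simp
      then have 1: "pinned_det (\<lambda>s t. f s t + b s t) h0 Q \<le> pinned_det f ?h1 Q"
        using pinned.IH(1) by blast
      have "pinned_det (\<lambda>s t. f s t + b s t) h Q =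
          pinned_det (\<lambda>s t. f s t + b s t) h0 Q
          + h q * pinned_det (\<lambda>s t. f s t + b s t) (\<lambda>s. h s + (f s q + b s q)) (Q - {q})"
        by (rule pinned_det_expand[OF pinned.hyps(1-3)])
      also have "\<dots> \<le> pinned_det f ?h1 Q + h q * pinned_det f (\<lambda>s. ?h1 s + f s q) (Q - {q})"
        using 2 1 hh pinned.hyps(2) by (intro add_mono mult_left_mono) auto
      \<comment> \<open>The pin of \<open>q\<close> in \<open>?h1\<close> is its degree in
        \<open>b\<close> rather than 0, so the two terms are joined by adding \<open>h q\<close> to
        an existing pin.\<close>
      also have "\<dots> = pinned_det f (?h1(q := ?h1 q + h q)) Q"
        by (rule pinned_det_add_pin[OF pinned.hyps(1,2), symmetric])
      also have "?h1(q := ?h1 q + h q) = (\<lambda>s. h s + ?deg s)" using pinned.hyps(3) by auto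
      finally show "pinned_det (\<lambda>s t. f s t + b s t) h Q \<le> pinned_det f (\<lambda>s. h s + ?deg s) Q" .
    qed
  qed
  then show ?thesis using h by blast
qed

text \<open>No edge leads from \<open>U\<close> to the root. In the expansion, a \<open>q\<close> in
  \<open>U\<close> has coefficient \<open>h q = 0\<close>, and a \<open>q\<close> outside
  \<open>U\<close> creates no pin on \<open>U\<close>.\<close>

lemma pinned_det_isolated:
  assumes "finite Q" "U \<subseteq> Q" "U \<noteq> {}" and h: "\<And>s. s \<in> U \<Longrightarrow> h s = 0"
    and f: "\<And>s t. s \<in> U \<Longrightarrow> t \<in> Q - U \<Longrightarrow> f s t = 0"
  shows "pinned_det f h Q = 0"
proof -
  have "U \<subseteq> Q \<and> (\<forall>s\<in>U. h s = 0) \<and> (\<forall>s\<in>U. \<forall>t\<in>Q - U. f s t = 0) \<longrightarrow> pinned_det f h Q = 0"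
    using assms(1)
  proof (induction Q h rule: pinned_induct)
    case (unpinned Q h)
    then show ?case using assms(3) by (cases "Q = {}") (auto simp: pinned_det_unpinned)
  next
    case (pinned Q h q h0)
    show ?case
    proof
      assume *: "U \<subseteq> Q \<and> (\<forall>s\<in>U. h s = 0) \<and> (\<forall>s\<in>U. \<forall>t\<in>Q - U. f s t = 0)"
      have "\<forall>s\<in>U. h0 s = 0" using pinned.hyps(3) * by simp
      then have "pinned_det f h0 Q = 0" using pinned.IH(1) * by blast
      moreover have "h q * pinned_det f (\<lambda>s. h s + f s q) (Q - {q}) = 0"
      proof (cases "q \<in> U")
        case False
        then show ?thesis using pinned.IH(2)[of "\<lambda>s. h s + f s q"] * pinned.hyps by auto
      qed (use * in simp)
      ultimately show "pinned_det f h Q = 0"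
        using pinned_det_expand[OF pinned.hyps(1-3), of f] by linarith
    qed
  qed
  then show ?thesis using assms by blast
qed

text \<open>The matrix is block diagonal only up to a permutation, as the increasing enumeration
  interleaves the two sets. The expansion avoids the permutation: a pin on one set leaves the other
  factor unchanged.\<close>

lemma pinned_det_Un:
  assumes "finite Q1" "finite Q2" "Q1 \<inter> Q2 = {}"
    and f: "\<And>s t. s \<in> Q1 \<Longrightarrow> t \<in> Q2 \<Longrightarrow> f s t = 0 \<and> f t s = 0"
  shows "pinned_det f h (Q1 \<union> Q2) = pinned_det f h Q1 * pinned_det f h Q2"
proof -
  define sep where "sep Q1 Q2 \<longleftrightarrow> Q1 \<inter> Q2 = {} \<and> (\<forall>s\<in>Q1. \<forall>t\<in>Q2. f s t = 0 \<and> f t s = 0)" for Q1 Q2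
  have "\<forall>Q1 Q2. Q = Q1 \<union> Q2 \<and> sep Q1 Q2 \<longrightarrow> pinned_det f h Q = pinned_det f h Q1 * pinned_det f h Q2"
    if "finite Q" for Q
    using that
  proof (induction Q h rule: pinned_induct)
    case (unpinned Q h)
    show ?case
    proof (intro allI impI)
      fix Q1 Q2 assume *: "Q = Q1 \<union> Q2 \<and> sep Q1 Q2"
      show "pinned_det f h Q = pinned_det f h Q1 * pinned_det f h Q2"
      proof (cases "Q1 = {}")
        case False
        then have "pinned_det f h Q = 0" "pinned_det f h Q1 = 0"
          using unpinned * by (auto intro!: pinned_det_unpinned)
        then show ?thesis by simp
      qed (use * in simp)
    qed
  next
    case (pinned Q h q h0)
    let ?h' = "\<lambda>s. h s + f s q"
    have step: "pinned_det f h Q = pinned_det f h Q1 * pinned_det f h Q2"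
      if Q: "Q = Q1 \<union> Q2" and s: "sep Q1 Q2" and q: "q \<in> Q1" for Q1 Q2
    proof -
      have fin: "finite Q1" "finite Q2" using Q pinned.hyps by auto
      have q2: "q \<notin> Q2" using s q by (auto simp: sep_def)
      \<comment> \<open>The factor on \<open>Q2\<close> sees neither the cancelled pin of
        \<open>q\<close> nor the new pins \<open>f s q\<close>, which vanish there.\<close>
      have c: "pinned_det f h0 Q2 = pinned_det f h Q2" "pinned_det f ?h' Q2 = pinned_det f h Q2"
        using fin q2 s q pinned.hyps(3) by (auto intro!: pinned_det_cong simp: sep_def)
      have "pinned_det f h0 Q = pinned_det f h0 Q1 * pinned_det f h0 Q2"
        using pinned.IH(1) Q s by blast
      moreover have "pinned_det f ?h' (Q - {q}) = pinned_det f ?h' (Q1 - {q}) * pinned_det f ?h' Q2"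
      proof -
        have "Q - {q} = (Q1 - {q}) \<union> Q2 \<and> sep (Q1 - {q}) Q2" using Q s q2 by (auto simp: sep_def)
        then show ?thesis using pinned.IH(2) by blast
      qed
      ultimately show ?thesis
        unfolding pinned_det_expand[OF pinned.hyps(1-3), of f] pinned_det_expand[OF fin(1) q pinned.hyps(3), of f] c
        by (simp add: algebra_simps)
    qed
    show ?case
    proof (intro allI impI)
      fix Q1 Q2 assume *: "Q = Q1 \<union> Q2 \<and> sep Q1 Q2"
      show "pinned_det f h Q = pinned_det f h Q1 * pinned_det f h Q2"
      proof (cases "q \<in> Q1")
        case True
        then show ?thesis using step * by blast
      next
        case False
        then have "Q = Q2 \<union> Q1" "sep Q2 Q1" "q \<in> Q2" using * pinned.hyps(2) by (auto simp: sep_def)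
        then have "pinned_det f h Q = pinned_det f h Q2 * pinned_det f h Q1" by (rule step)
        then show ?thesis by (simp only: mult.commute)
      qed
    qed
  qed
  moreover have "finite (Q1 \<union> Q2)" "sep Q1 Q2" using assms by (auto simp: sep_def)
  ultimately show ?thesis by blast
qed

lemma pinned_det_UN:
  assumes "finite I" "\<And>k. k \<in> I \<Longrightarrow> finite (A k)" "disjoint_family_on A I"
    and f: "\<And>k l s t. k \<in> I \<Longrightarrow> l \<in> I \<Longrightarrow> k \<noteq> l \<Longrightarrow> s \<in> A k \<Longrightarrow> t \<in> A l \<Longrightarrow> f s t = 0"
  shows "pinned_det f h (\<Union>k\<in>I. A k) = (\<Prod>k\<in>I. pinned_det f h (A k))"
  using assms
proof (induction I rule: finite_induct)
  case (insert i I)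
  have "A i \<inter> (\<Union>k\<in>I. A k) = {}"
    using insert.prems(2) insert.hyps by (fastforce simp: disjoint_family_on_def)
  moreover have "f s t = 0 \<and> f t s = 0" if "s \<in> A i" "t \<in> (\<Union>k\<in>I. A k)" for s t
    using that insert.hyps insert.prems(3)[of i _ s t] insert.prems(3)[of _ i t s] by blast
  moreover have "disjoint_family_on A I"
    using insert.prems(2) by (auto simp: disjoint_family_on_def)
  then have "pinned_det f h (\<Union>k\<in>I. A k) = (\<Prod>k\<in>I. pinned_det f h (A k))"
    using insert.prems(1,3) by (intro insert.IH) blast+
  ultimately show ?case
    using insert.hyps insert.prems(1) pinned_det_Un[of "A i" "\<Union>k\<in>I. A k" f h] by simp
qed simp

section \<open>Principal minors and rank deficiency\<close>

text \<open>Maximum principle: at a largest entry of \<open>v\<close>, the row equation writes 0 as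
  a sum of nonnegative terms. All weights are positive, so every other entry equals the largest
  one.\<close>

lemma laplacian_kernel_constant:
  fixes v :: "real Matrix.vec"
  assumes d: "distinct xs" and pos: "\<And>s t. s \<noteq> t \<Longrightarrow> 0 < f s t"
    and v: "v \<in> carrier_vec (length xs)" "pinned_mat f (\<lambda>_. 0) xs *\<^sub>v v = 0\<^sub>v (length xs)"
    and ab: "a < length xs" "b < length xs"
  shows "v $ a = v $ b"
proof -
  let ?n = "length xs"
  let ?L = "pinned_mat f (\<lambda>_. 0) xs"
  have balance: "(\<Sum>b \<in> {0..<?n} - {a}. f (xs ! a) (xs ! b) * (v $ a - v $ b)) = 0" if a: "a < ?n" for a
  proof -
    have "bij_betw (\<lambda>b. xs ! b) ({0..<?n} - {a}) (set xs - {xs ! a})"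
      using d a by (intro bij_betwI') (auto simp: nth_eq_iff_index_eq in_set_conv_nth)
    then have deg: "(\<Sum>t \<in> set xs - {xs ! a}. f (xs ! a) t) = (\<Sum>b \<in> {0..<?n} - {a}. f (xs ! a) (xs ! b))"
      by (rule sum.reindex_bij_betw[symmetric])
    have "0 = (?L *\<^sub>v v) $ a" using v a by simp
    also have "\<dots> = (\<Sum>b = 0..<?n. ?L $$ (a, b) * v $ b)"
      using a v(1) pinned_mat_carrier[of f "\<lambda>_. 0" xs] by (auto simp: mult_mat_vec_def scalar_prod_def)
    also have "\<dots> = ?L $$ (a, a) * v $ a + (\<Sum>b \<in> {0..<?n} - {a}. ?L $$ (a, b) * v $ b)"
      using a by (subst sum.remove[of _ a]) auto
    also have "(\<Sum>b \<in> {0..<?n} - {a}. ?L $$ (a, b) * v $ b) =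
        (\<Sum>b \<in> {0..<?n} - {a}. - f (xs ! a) (xs ! b) * v $ b)"
      using a by (intro sum.cong) (auto simp: pinned_mat_def)
    also have "?L $$ (a, a) = (\<Sum>b \<in> {0..<?n} - {a}. f (xs ! a) (xs ! b))"
      using a deg by (simp add: pinned_mat_def)
    finally show ?thesis
      by (simp add: sum_distrib_right right_diff_distrib sum_subtractf sum_negf)
  qed
  define m where "m = Max ((\<lambda>a. v $ a) ` {0..<?n})"
  have "m \<in> (\<lambda>a. v $ a) ` {0..<?n}" unfolding m_def using ab by (intro Max_in) auto
  then obtain c where c: "c < ?n" "v $ c = m" by auto
  have le: "v $ b \<le> v $ c" if "b < ?n" for b
    unfolding c m_def using that by (intro Max_ge) auto
  have "v $ b = v $ c" if b: "b < ?n" for b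
  proof (cases "b = c")
    case False
    have nn: "0 \<le> f (xs ! c) (xs ! b) * (v $ c - v $ b)" if "b \<in> {0..<?n} - {c}" for b
      using that le[of b] pos[of "xs ! c" "xs ! b"] c d by (simp add: nth_eq_iff_index_eq)
    have "f (xs ! c) (xs ! b) * (v $ c - v $ b) = 0"
      using sum_nonneg_eq_0_iff[THEN iffD1, OF _ nn balance[OF c(1)]] False b by simp
    then show ?thesis
      using pos[of "xs ! c" "xs ! b"] False b c d by (simp add: nth_eq_iff_index_eq)
  qed simp
  then show ?thesis using ab by simp
qed

text \<open>The rows and the columns of the adjugate lie in the kernel of the Laplacian, hence the adjugate
  is a constant matrix.\<close>

lemma pinned_det_root_independent:
  assumes V: "finite V" "r \<in> V" "r' \<in> V" and pos: "\<And>s t. s \<noteq> t \<Longrightarrow> 0 < f s t"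
    and sym: "\<And>s t. f s t = f t s"
  shows "pinned_det f (\<lambda>s. f s r) (V - {r}) = pinned_det f (\<lambda>s. f s r') (V - {r'})"
proof -
  let ?xs = "sorted_list_of_set V" and ?n = "card V"
  let ?L = "pinned_mat f (\<lambda>_. 0) ?xs"
  have set: "set ?xs = V" "distinct ?xs" "length ?xs = ?n" using V by auto
  have L: "?L \<in> carrier_mat ?n ?n" using pinned_mat_carrier[of f "\<lambda>_. 0" ?xs] set by simp
  have symL: "transpose_mat ?L = ?L"
    by (intro eq_matI) (auto simp: pinned_mat_def sym)
  have det0: "Determinant.det ?L = 0"
    using pinned_det_unpinned[of V "\<lambda>_. 0" f] V by (auto simp: pinned_det_def)
  let ?A = "adj_mat ?L"
  have A: "?A \<in> carrier_mat ?n ?n" using adj_mat[OF L] by simp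
  have kern: "w $ a = w $ b" if "w \<in> carrier_vec ?n" "?L *\<^sub>v w = 0\<^sub>v ?n" "a < ?n" "b < ?n" for w :: "real Matrix.vec" and a b
    using laplacian_kernel_constant[OF set(2), of f w a b] pos that set by simp
  have LA: "?L * ?A = 0\<^sub>m ?n ?n" and AL: "?A * ?L = 0\<^sub>m ?n ?n"
    using adj_mat(2,3)[OF L] by (auto simp: det0)
  have col: "?A $$ (a, j) = ?A $$ (b, j)" if "a < ?n" "b < ?n" "j < ?n" for a b j
  proof -
    have "?L *\<^sub>v col ?A j = col (?L * ?A) j" using A L that by (metis col_mult2)
    then have "?L *\<^sub>v col ?A j = 0\<^sub>v ?n" using LA that by simp
    moreover have "col ?A j \<in> carrier_vec ?n" using A col_dim[of ?A j] by simp
    ultimately have "col ?A j $ a = col ?A j $ b" using kern that by blast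
    then show ?thesis using A that by auto
  qed
  have row: "?A $$ (j, a) = ?A $$ (j, b)" if "a < ?n" "b < ?n" "j < ?n" for a b j
  proof -
    have "?L * transpose_mat ?A = transpose_mat (?A * ?L)"
      using transpose_mult[OF A L] symL by simp
    then have Z: "?L * transpose_mat ?A = 0\<^sub>m ?n ?n" using AL by simp
    have "?L *\<^sub>v col (transpose_mat ?A) j = col (?L * transpose_mat ?A) j"
      using A L that by (metis col_mult2 transpose_carrier_mat)
    then have "?L *\<^sub>v col (transpose_mat ?A) j = 0\<^sub>v ?n" using Z that by simp
    moreover have "col (transpose_mat ?A) j \<in> carrier_vec ?n" using A col_dim[of "transpose_mat ?A" j] by simp
    ultimately have "col (transpose_mat ?A) j $ a = col (transpose_mat ?A) j $ b"
      using kern that by blast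
    then show ?thesis using A that by auto
  qed
  \<comment> \<open>A diagonal entry of the adjugate is the minor with that vertex as root, so two
    choices of root are two entries of a constant matrix.\<close>
  have minor: "\<exists>i<?n. pinned_det f (\<lambda>s. f s r) (V - {r}) = ?A $$ (i, i)" if r: "r \<in> V" for r
  proof -
    obtain i where i: "i < ?n" "?xs ! i = r" using r set by (metis in_set_conv_nth)
    have "?A $$ (i, i) = Determinant.det (mat_delete ?L i i)"
      using i L by (simp add: adj_mat_def cofactor_def)
    also have "\<dots> = pinned_det f (\<lambda>s. f s r) (V - {r})"
      using mat_delete_pinned_mat[of ?xs i f "\<lambda>_. 0"] i set V
      by (simp add: pinned_det_def sorted_list_of_set_remove)
    finally show ?thesis using i by auto
  qed
  obtain i j where "i < ?n" "pinned_det f (\<lambda>s. f s r) (V - {r}) = ?A $$ (i, i)"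
    "j < ?n" "pinned_det f (\<lambda>s. f s r') (V - {r'}) = ?A $$ (j, j)"
    using minor V by blast
  then show ?thesis using col[of i j i] row[of i j j] by simp
qed

text \<open>The minor on \<open>Q\<close> of the Laplacian of \<open>a\<close> on \<open>N\<close>.\<close>

definition principal_minor :: "(nat \<Rightarrow> nat \<Rightarrow> real) \<Rightarrow> nat set \<Rightarrow> nat set \<Rightarrow> real" where
  "principal_minor a N Q = pinned_det a (\<lambda>s. \<Sum>t \<in> N - Q. a s t) Q"

definition within_blocks :: "(nat \<Rightarrow> 'i) \<Rightarrow> (nat \<Rightarrow> nat \<Rightarrow> real) \<Rightarrow> nat \<Rightarrow> nat \<Rightarrow> real" where
  "within_blocks lab f s t = (if lab s = lab t then f s t else 0)"

text \<open>For symmetric weights this is the total weight of the spanning trees of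
  \<open>V\<close>, by the matrix-tree theorem; the root \<open>Min V\<close> matches the row
  deleted in \<open>laplacian_minor\<close>.\<close>

definition tree_weight :: "(nat \<Rightarrow> nat \<Rightarrow> real) \<Rightarrow> nat set \<Rightarrow> real" where
  "tree_weight f V = pinned_det f (\<lambda>s. f s (Min V)) (V - {Min V})"

abbreviation label_class :: "nat set \<Rightarrow> (nat \<Rightarrow> 'i) \<Rightarrow> 'i \<Rightarrow> nat set" where
  "label_class N lab k \<equiv> {i \<in> N. lab i = k}"

text \<open>Once the edges between blocks are gone, the minor factors over the blocks, and in each
  block only its own representative acts as root. By root independence any choice of representatives
  gives the same product.\<close>

lemma principal_minor_transversal:
  assumes N: "finite N" and I: "finite I" "lab ` N \<subseteq> I"
    and \<rho>: "\<And>k. k \<in> I \<Longrightarrow> \<rho> k \<in> N \<and> lab (\<rho> k) = k"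
    and pos: "\<And>s t. s \<noteq> t \<Longrightarrow> 0 < f s t" and sym: "\<And>s t. f s t = f t s"
  shows "principal_minor (within_blocks lab f) N (N - \<rho> ` I) = (\<Prod>k\<in>I. tree_weight f (label_class N lab k))"
proof -
  let ?g = "within_blocks lab f"
  let ?h = "\<lambda>s. \<Sum>t \<in> \<rho> ` I. ?g s t"
  have "N - (N - \<rho> ` I) = \<rho> ` I" using \<rho> by auto
  then have "principal_minor ?g N (N - \<rho> ` I) = pinned_det ?g ?h (N - \<rho> ` I)"
    by (simp add: principal_minor_def)
  also have "\<dots> = pinned_det ?g ?h (\<Union>k\<in>I. label_class N lab k - {\<rho> k})"
    using I \<rho> by (intro arg_cong[of _ _ "pinned_det ?g ?h"]) fastforce
  also have "\<dots> = (\<Prod>k\<in>I. pinned_det ?g ?h (label_class N lab k - {\<rho> k}))"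
    using N I(1) by (intro pinned_det_UN) (auto simp: disjoint_family_on_def within_blocks_def)
  also have "\<dots> = (\<Prod>k\<in>I. tree_weight f (label_class N lab k))"
  proof (intro prod.cong refl)
    fix k assume k: "k \<in> I"
    have "?h s = f s (\<rho> k)" if s: "s \<in> label_class N lab k - {\<rho> k}" for s
    proof -
      have "?h s = (\<Sum>l\<in>I. ?g s (\<rho> l))"
        using \<rho> by (subst sum.reindex) (auto simp: inj_on_def, metis)
      also have "\<dots> = (\<Sum>l\<in>I. if l = k then f s (\<rho> k) else 0)"
        using s \<rho> by (intro sum.cong) (auto simp: within_blocks_def)
      finally show ?thesis using k I by simp
    qed
    then have "pinned_det ?g ?h (label_class N lab k - {\<rho> k}) = pinned_det f (\<lambda>s. f s (\<rho> k)) (label_class N lab k - {\<rho> k})"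
      using N by (intro pinned_det_cong) (auto simp: within_blocks_def)
    also have "\<dots> = tree_weight f (label_class N lab k)"
    proof -
      have "\<rho> k \<in> label_class N lab k" using \<rho> k by auto
      moreover from this have "Min (label_class N lab k) \<in> label_class N lab k" using N by (intro Min_in) auto
      ultimately show ?thesis unfolding tree_weight_def
        using N by (intro pinned_det_root_independent pos sym) auto
    qed
    finally show "pinned_det ?g ?h (label_class N lab k - {\<rho> k}) = tree_weight f (label_class N lab k)" .
  qed
  finally show ?thesis .
qed

lemma principal_minor_nonneg:
  assumes "finite N" "Q \<subseteq> N" "\<And>s t. 0 \<le> a s t"
  shows "0 \<le> principal_minor a N Q"
  unfolding principal_minor_def using assms finite_subset[OF assms(2,1)]
  by (intro pinned_det_nonneg) (auto intro: sum_nonneg)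

text \<open>In the minor on \<open>insert q Q\<close>, the pin of \<open>q\<close> contains the edge
  to \<open>r\<close>, which is still outside. The coefficient of that edge is the minor on
  \<open>Q\<close>, and what remains is nonnegative.\<close>

lemma principal_minor_insert:
  assumes N: "finite N" "Q \<subseteq> N" "q \<in> N - Q" "r \<in> N - Q" "q \<noteq> r"
    and a: "\<And>s t. 0 \<le> a s t" and \<delta>: "\<delta> \<le> a q r"
  shows "\<delta> * principal_minor a N Q \<le> principal_minor a N (insert q Q)"
proof -
  let ?h = "\<lambda>s. \<Sum>t \<in> N - insert q Q. a s t"
  define h0 where "h0 = ?h(q := ?h q - a q r)"
  have fin: "finite Q" using finite_subset[OF N(2,1)] .
  have "principal_minor a N (insert q Q) = pinned_det a (h0(q := h0 q + a q r)) (insert q Q)"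
  proof -
    have "h0(q := h0 q + a q r) = ?h" by (auto simp: h0_def)
    then show ?thesis by (simp only: principal_minor_def)
  qed
  also have "\<dots> = pinned_det a h0 (insert q Q) + a q r * pinned_det a (\<lambda>s. h0 s + a s q) (insert q Q - {q})"
    using fin by (intro pinned_det_add_pin) auto
  also have "insert q Q - {q} = Q" using N by auto
  also have "pinned_det a (\<lambda>s. h0 s + a s q) Q = principal_minor a N Q"
    unfolding principal_minor_def
  proof (intro pinned_det_cong fin)
    fix s assume "s \<in> Q"
    then have "s \<noteq> q" using N by auto
    have NQ: "N - Q = insert q (N - insert q Q)" using N by auto
    have "(\<Sum>t \<in> N - Q. a s t) = a s q + ?h s" unfolding NQ using N by (subst sum.insert) auto
    then show "h0 s + a s q = (\<Sum>t \<in> N - Q. a s t)" using \<open>s \<noteq> q\<close> by (simp add: h0_def)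
  qed simp
  finally have eq: "principal_minor a N (insert q Q) =
    pinned_det a h0 (insert q Q) + a q r * principal_minor a N Q" .
  have "a q r \<le> ?h q" using N a by (intro member_le_sum) auto
  then have "0 \<le> pinned_det a h0 (insert q Q)"
    using fin a by (intro pinned_det_nonneg) (auto simp: h0_def intro: sum_nonneg)
  moreover have "\<delta> * principal_minor a N Q \<le> a q r * principal_minor a N Q"
    using \<delta> principal_minor_nonneg[OF N(1,2) a] by (intro mult_right_mono) auto
  ultimately show ?thesis using eq by linarith
qed

lemma principal_minor_isolated:
  assumes "finite N" "Q \<subseteq> N" "U \<subseteq> Q" "U \<noteq> {}" "\<And>s t. s \<in> U \<Longrightarrow> t \<in> N - U \<Longrightarrow> a s t = 0"
  shows "principal_minor a N Q = 0"
  unfolding principal_minor_def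
proof (rule pinned_det_isolated[of _ U])
  fix s assume "s \<in> U"
  then show "(\<Sum>t \<in> N - Q. a s t) = 0" using assms by (intro sum.neutral) blast
qed (use assms finite_subset[OF assms(2,1)] in auto)

lemma tree_weight_nonneg:
  assumes "finite V" "\<And>s t. 0 \<le> f s t"
  shows "0 \<le> tree_weight f V"
  unfolding tree_weight_def using assms by (intro pinned_det_nonneg) auto

section \<open>Comparing the minors of two partitions\<close>

text \<open>\<open>Q\<close> is enlarged one point at a time, each at the price of a factor
  \<open>\<delta>\<close>, until one point per block is left outside; there the minor is the product
  itself. Powers of \<open>\<delta>\<close> stand on both sides because \<open>card Q\<close> may
  lie on either side of \<open>card N - card I\<close>.\<close>

lemma principal_minor_le:
  assumes N: "finite N" and I: "finite I" "lab ` N = I"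
    and pos: "\<And>s t. 0 < f s t" and sym: "\<And>s t. f s t = f t s"
    and \<delta>: "0 < \<delta>" "\<And>s t. s \<in> N \<Longrightarrow> t \<in> N \<Longrightarrow> s \<noteq> t \<Longrightarrow> lab s = lab t \<Longrightarrow> \<delta> \<le> f s t"
    and Q: "Q \<subseteq> N"
  shows "principal_minor (within_blocks lab f) N Q * \<delta> ^ (card N - card I) \<le>
    (\<Prod>k\<in>I. tree_weight f (label_class N lab k)) * \<delta> ^ card Q"
  using Q
proof (induction "card (N - Q)" arbitrary: Q rule: less_induct)
  case (less Q)
  let ?g = "within_blocks lab f" and ?T = "\<Prod>k\<in>I. tree_weight f (label_class N lab k)"
  have g: "0 \<le> ?g s t" for s t using pos[of s t] by (simp add: within_blocks_def)
  have fin: "finite Q" using finite_subset[OF less.prems N] .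
  have T: "0 \<le> ?T" using pos N by (intro prod_nonneg tree_weight_nonneg ballI) (auto intro: less_imp_le)
  \<comment> \<open>The number of points of each block outside \<open>Q\<close> decides: none in
    some block (the minor vanishes), at least two in some block (\<open>Q\<close> can grow), or
    exactly one in every block.\<close>
  consider (full) k where "k \<in> I" "label_class N lab k \<subseteq> Q"
    | (two) q r where "q \<in> N - Q" "r \<in> N - Q" "q \<noteq> r" "lab q = lab r"
    | (one) "\<And>k. k \<in> I \<Longrightarrow> \<not> label_class N lab k \<subseteq> Q" "inj_on lab (N - Q)"
    by (auto simp: inj_on_def)
  then show ?case
  proof cases
    case full
    have "principal_minor ?g N Q = 0"
      using full I by (intro principal_minor_isolated[OF N less.prems full(2)]) (auto simp: within_blocks_def)
    then show ?thesis using T \<delta> by simp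
  next
    case two
    have "N - insert q Q \<subset> N - Q" using two by auto
    then have "card (N - insert q Q) < card (N - Q)" using N by (intro psubset_card_mono) auto
    then have IH: "principal_minor ?g N (insert q Q) * \<delta> ^ (card N - card I) \<le> ?T * \<delta> ^ card (insert q Q)"
      using two less.prems by (intro less.hyps) auto
    have "\<delta> \<le> ?g q r" using two \<delta>(2)[of q r] by (auto simp: within_blocks_def)
    then have "\<delta> * principal_minor ?g N Q \<le> principal_minor ?g N (insert q Q)"
      using two by (intro principal_minor_insert[OF N less.prems] g) auto
    then have "\<delta> * principal_minor ?g N Q * \<delta> ^ (card N - card I) \<le>
        principal_minor ?g N (insert q Q) * \<delta> ^ (card N - card I)"
      using \<delta> by (intro mult_right_mono) auto
    also note IH
    also have "?T * \<delta> ^ card (insert q Q) = \<delta> * (?T * \<delta> ^ card Q)" using two fin by simp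
    finally show ?thesis using \<delta>(1) by (simp add: mult.assoc)
  next
    case one
    define \<rho> where "\<rho> = the_inv_into (N - Q) lab"
    have im: "lab ` (N - Q) = I"
    proof
      show "I \<subseteq> lab ` (N - Q)" using one(1) by (force simp: subset_eq)
    qed (use I in auto)
    have \<rho>: "\<rho> ` I = N - Q" "\<And>k. k \<in> I \<Longrightarrow> \<rho> k \<in> N \<and> lab (\<rho> k) = k"
      unfolding \<rho>_def im[symmetric] using one(2)
      by (auto simp: the_inv_into_f_f the_inv_into_onto f_the_inv_into_f intro: the_inv_into_into)
    have QN: "Q = N - \<rho> ` I" using \<rho> less.prems by auto
    have "card I = card (N - Q)" using im one(2) card_image by force
    then have "card Q = card N - card I" using card_Diff_subset[OF fin less.prems] card_mono[OF N less.prems] by simp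
    moreover have "principal_minor ?g N Q = ?T"
      unfolding QN using I pos sym \<rho>(2) by (intro principal_minor_transversal[OF N I(1)]) auto
    ultimately show ?thesis by simp
  qed
qed

text \<open>The minor on the empty set is 1, so the preceding bound at \<open>{}\<close> keeps the
  product away from 0.\<close>

lemma prod_tree_weight_pos:
  assumes N: "finite N" and I: "finite I" "lab ` N = I"
    and pos: "\<And>s t. 0 < f s t" and sym: "\<And>s t. f s t = f t s"
  shows "0 < (\<Prod>k\<in>I. tree_weight f (label_class N lab k))"
proof -
  \<comment> \<open>The inserted 1 keeps the minimum meaningful when \<open>N\<close> is
    empty.\<close>
  define \<delta> where "\<delta> = Min (insert 1 ((\<lambda>(s, t). f s t) ` (N \<times> N)))"
  have "finite (insert 1 ((\<lambda>(s, t). f s t) ` (N \<times> N)))" using N by simp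
  then have "0 < \<delta>" "\<And>s t. s \<in> N \<Longrightarrow> t \<in> N \<Longrightarrow> \<delta> \<le> f s t"
    using pos by (auto simp: \<delta>_def intro!: Min_le)
  then have "principal_minor (within_blocks lab f) N {} * \<delta> ^ (card N - card I) \<le>
    (\<Prod>k\<in>I. tree_weight f (label_class N lab k)) * \<delta> ^ card ({} :: nat set)"
    by (intro principal_minor_le[OF N I pos sym]) auto
  moreover have "0 < \<delta> ^ (card N - card I)" using \<open>0 < \<delta>\<close> by simp
  ultimately show ?thesis by (simp add: principal_minor_def)
qed

text \<open>Pins of size \<open>u * \<delta>\<close> are added one by one. Each costs a vertex of
  \<open>Q\<close>, hence a factor \<open>\<delta>\<close> in the bound, and so contributes a
  relative factor \<open>u\<close>. The unperturbed minor is kept exactly, because it will vanish in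
  the application.\<close>

lemma principal_minor_perturb:
  assumes N: "finite N" "Q \<subseteq> N" and Y: "Y \<subseteq> Q" and a: "\<And>s t. 0 \<le> a s t"
    and C: "\<And>Q. Q \<subseteq> N \<Longrightarrow> principal_minor a N Q \<le> C * \<delta> ^ card Q" and \<delta>: "0 < \<delta>" and u: "0 \<le> u"
  shows "pinned_det a (\<lambda>s. (\<Sum>t \<in> N - Q. a s t) + (if s \<in> Y then u * \<delta> else 0)) Q \<le>
    principal_minor a N Q + C * \<delta> ^ card Q * ((1 + u) ^ card Y - 1)"
proof -
  have "finite Y" using finite_subset[OF Y finite_subset[OF N(2,1)]] .
  then show ?thesis using N(2) Y
  proof (induction Y arbitrary: Q rule: finite_induct)
    case (insert q Y Q)
    have fin: "finite Q" using finite_subset[OF insert.prems(1) N(1)] .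
    have q: "q \<in> Q" "q \<in> N" using insert.prems by auto
    let ?pin = "\<lambda>Q Y s. (\<Sum>t \<in> N - Q. a s t) + (if s \<in> Y then u * \<delta> else 0)"
    let ?E = "(1 + u) ^ card Y"
    obtain m where m: "card Q = Suc m" "card (Q - {q}) = m"
      using q fin by (metis card_Suc_Diff1)
    have "?pin Q (insert q Y) = (?pin Q Y)(q := ?pin Q Y q + u * \<delta>)"
      using insert.hyps by auto
    then have "pinned_det a (?pin Q (insert q Y)) Q =
        pinned_det a (?pin Q Y) Q + u * \<delta> * pinned_det a (\<lambda>s. ?pin Q Y s + a s q) (Q - {q})"
      using pinned_det_add_pin[OF fin q(1), of a "?pin Q Y" "u * \<delta>"] by simp
    also have "pinned_det a (\<lambda>s. ?pin Q Y s + a s q) (Q - {q}) = pinned_det a (?pin (Q - {q}) Y) (Q - {q})"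
    proof (intro pinned_det_cong)
      fix s
      have "N - (Q - {q}) = insert q (N - Q)" using q by auto
      then have "(\<Sum>t \<in> N - (Q - {q}). a s t) = a s q + (\<Sum>t \<in> N - Q. a s t)" using q N by simp
      then show "?pin Q Y s + a s q = ?pin (Q - {q}) Y s" by simp
    qed (use fin in auto)
    also have "pinned_det a (?pin Q Y) Q \<le> principal_minor a N Q + C * \<delta> ^ Suc m * (?E - 1)"
      using insert.prems insert.IH[of Q] m by auto
    also have "pinned_det a (?pin (Q - {q}) Y) (Q - {q}) \<le> C * \<delta> ^ m * ?E"
    proof -
      have "pinned_det a (?pin (Q - {q}) Y) (Q - {q}) \<le>
          principal_minor a N (Q - {q}) + C * \<delta> ^ m * (?E - 1)"
        using insert.prems insert.hyps insert.IH[of "Q - {q}"] m by auto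
      also have "\<dots> \<le> C * \<delta> ^ m + C * \<delta> ^ m * (?E - 1)"
        using C[of "Q - {q}"] m insert.prems by auto
      finally show ?thesis by (simp add: algebra_simps)
    qed
    finally have "pinned_det a (?pin Q (insert q Y)) Q \<le>
        principal_minor a N Q + C * \<delta> ^ Suc m * (?E - 1) + u * \<delta> * (C * \<delta> ^ m * ?E)"
      using \<delta> u by (simp add: mult_left_mono)
    also have "\<dots> = principal_minor a N Q + C * \<delta> ^ card Q * ((1 + u) ^ card (insert q Y) - 1)"
      using insert.hyps m by (simp add: algebra_simps)
    finally show ?case .
  qed (simp add: principal_minor_def)
qed

text \<open>Inside the classes of \<open>lab\<close> the weights split into \<open>a\<close>,
  joining equal \<open>lab0\<close> labels, and \<open>b\<close>, the rest. \<open>a\<close> is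
  dominated by the Laplacian of \<open>lab0\<close>, and its minor on \<open>R\<close> vanishes, so
  only terms with pins from \<open>b\<close> survive, each of relative size at most
  \<open>u\<close>.\<close>

lemma prod_tree_weight_le:
  assumes N: "finite N" and I: "finite I" "lab0 ` N = I" "lab ` N = I"
    and pos: "\<And>s t. 0 < f s t" and sym: "\<And>s t. f s t = f t s"
    and \<delta>: "0 < \<delta>" "\<And>s t. s \<in> N \<Longrightarrow> t \<in> N \<Longrightarrow> s \<noteq> t \<Longrightarrow> lab0 s = lab0 t \<Longrightarrow> \<delta> \<le> f s t"
    and \<epsilon>: "\<And>s t. s \<in> N \<Longrightarrow> t \<in> N \<Longrightarrow> lab0 s \<noteq> lab0 t \<Longrightarrow> f s t \<le> \<epsilon>"
    and split: "s0 \<in> N" "t0 \<in> N" "lab s0 = lab t0" "lab0 s0 \<noteq> lab0 t0"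
  shows "(\<Prod>k\<in>I. tree_weight f (label_class N lab k)) \<le>
    (\<Prod>k\<in>I. tree_weight f (label_class N lab0 k)) * ((1 + real (card N) * \<epsilon> / \<delta>) ^ card N - 1)"
proof -
  let ?T = "\<Prod>k\<in>I. tree_weight f (label_class N lab0 k)"
  define a where "a = within_blocks lab (within_blocks lab0 f)"
  define b where "b s t = (if lab s = lab t \<and> lab0 s \<noteq> lab0 t then f s t else 0)" for s t
  define \<rho> where "\<rho> k = Min (label_class N lab k)" for k
  define R where "R = N - \<rho> ` I"
  define u where "u = real (card N) * \<epsilon> / \<delta>"
  have f0: "0 \<le> f s t" for s t using pos[of s t] by simp
  have a0: "0 \<le> a s t" and b0: "0 \<le> b s t" for s t
    using f0[of s t] by (auto simp: a_def b_def within_blocks_def)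
  have \<epsilon>0: "0 \<le> \<epsilon>" using \<epsilon>[OF split(1,2,4)] pos[of s0 t0] by linarith
  have b\<epsilon>: "b s t \<le> \<epsilon>" if "s \<in> N" "t \<in> N" for s t
    using \<epsilon>[OF that] \<epsilon>0 by (simp add: b_def)
  have u: "0 \<le> u" "u * \<delta> = real (card N) * \<epsilon>" using \<epsilon>0 \<delta>(1) by (auto simp: u_def)
  have ab: "within_blocks lab f = (\<lambda>s t. a s t + b s t)"
    by (auto simp: fun_eq_iff a_def b_def within_blocks_def)
  have \<rho>: "\<rho> k \<in> N \<and> lab (\<rho> k) = k" if "k \<in> I" for k
  proof -
    have "k \<in> lab ` N" using that I by simp
    then have "label_class N lab k \<noteq> {}" by blast
    then have "\<rho> k \<in> label_class N lab k" unfolding \<rho>_def using N by (intro Min_in) auto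
    then show ?thesis by auto
  qed
  have R: "R \<subseteq> N" "finite R" using N by (auto simp: R_def)
  have "inj_on \<rho> I" using \<rho> by (metis inj_onI)
  then have "card (\<rho> ` I) = card I" by (rule card_image)
  then have cardR: "card R = card N - card I"
    unfolding R_def using I \<rho> by (subst card_Diff_subset) auto
  have T0: "0 \<le> ?T" using f0 N by (intro prod_nonneg tree_weight_nonneg ballI) auto
  \<comment> \<open>Normalised so that \<open>C * \<delta> ^ card R\<close> is the product for
    \<open>lab0\<close>, \<open>R\<close> being the index set whose minor represents
    \<open>lab\<close>.\<close>
  define C where "C = ?T / \<delta> ^ card R"
  have bound: "principal_minor a N Q \<le> C * \<delta> ^ card Q" if Q: "Q \<subseteq> N" for Q
  proof -
    have "principal_minor a N Q \<le> principal_minor (within_blocks lab0 f) N Q"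
      unfolding principal_minor_def using finite_subset[OF Q N] a0 f0
      by (intro pinned_det_mono) (auto simp: a_def within_blocks_def intro!: sum_mono sum_nonneg)
    moreover have "principal_minor (within_blocks lab0 f) N Q * \<delta> ^ card R \<le> ?T * \<delta> ^ card Q"
      unfolding cardR by (intro principal_minor_le N I pos sym \<delta> Q)
    then have "principal_minor (within_blocks lab0 f) N Q \<le> C * \<delta> ^ card Q"
      using \<delta>(1) by (simp add: C_def field_simps)
    ultimately show ?thesis by linarith
  qed
  \<comment> \<open>The root of the class shared by \<open>s0\<close> and \<open>t0\<close> cannot
    carry the \<open>lab0\<close> label of both.\<close>
  have "\<exists>s\<in>N. lab s = lab s0 \<and> lab0 s \<noteq> lab0 (\<rho> (lab s0))"
    using split by (cases "lab0 s0 = lab0 (\<rho> (lab s0))") metis+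
  then obtain s1 where s1: "s1 \<in> N" "lab s1 = lab s0" "lab0 s1 \<noteq> lab0 (\<rho> (lab s0))" by blast
  txt \<open>Each class of \<open>lab\<close> contains only one root, so splitting a class leaves a piece without root.\<close>
  have singular: "principal_minor a N R = 0"
  proof (rule principal_minor_isolated[OF N R(1)])
    let ?U = "{i \<in> N. lab i = lab s1 \<and> lab0 i = lab0 s1}"
    have "i \<notin> \<rho> ` I" if "i \<in> ?U" for i
      using that s1 \<rho> by auto
    then show "?U \<subseteq> R" by (auto simp: R_def)
    show "?U \<noteq> {}" using s1 by auto
    show "a s t = 0" if "s \<in> ?U" "t \<in> N - ?U" for s t
      using that by (auto simp: a_def within_blocks_def)
  qed
  have "(\<Prod>k\<in>I. tree_weight f (label_class N lab k)) = principal_minor (within_blocks lab f) N R"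
    unfolding R_def using I \<rho> pos sym by (intro principal_minor_transversal[symmetric] N) auto
  also have "\<dots> = pinned_det (\<lambda>s t. a s t + b s t) (\<lambda>s. \<Sum>t \<in> N - R. a s t + b s t) R"
    by (simp add: principal_minor_def ab)
  \<comment> \<open>Edges of \<open>b\<close> towards roots are pins already; those inside
    \<open>R\<close> are turned into pins, so that \<open>b\<close> now enters through the pins
    alone.\<close>
  also have "\<dots> \<le> pinned_det a (\<lambda>s. (\<Sum>t \<in> N - R. a s t + b s t) + (\<Sum>t \<in> R - {s}. b s t)) R"
    using R a0 b0 by (intro pinned_det_edges_to_pins) (auto intro!: sum_nonneg add_nonneg_nonneg)
  also have "\<dots> \<le> pinned_det a (\<lambda>s. (\<Sum>t \<in> N - R. a s t) + (if s \<in> R then u * \<delta> else 0)) R"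
  proof (intro pinned_det_mono)
    fix s assume s: "s \<in> R"
    have "(\<Sum>t \<in> N - R. b s t) + (\<Sum>t \<in> R - {s}. b s t) = (\<Sum>t \<in> (N - R) \<union> (R - {s}). b s t)"
      using N R by (intro sum.union_disjoint[symmetric]) auto
    also have "\<dots> \<le> (\<Sum>t \<in> N. b s t)" using N R b0 by (intro sum_mono2) auto
    also have "\<dots> \<le> (\<Sum>t \<in> N. \<epsilon>)" using s R b\<epsilon> by (intro sum_mono) auto
    also have "\<dots> = u * \<delta>" by (simp add: u)
    finally show "(\<Sum>t \<in> N - R. a s t + b s t) + (\<Sum>t \<in> R - {s}. b s t) \<le>
      (\<Sum>t \<in> N - R. a s t) + (if s \<in> R then u * \<delta> else 0)"
      using s by (simp add: sum.distrib)
  qed (use R a0 b0 in \<open>auto intro!: sum_nonneg add_nonneg_nonneg\<close>)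
  also have "\<dots> \<le> principal_minor a N R + C * \<delta> ^ card R * ((1 + u) ^ card R - 1)"
    by (intro principal_minor_perturb N R bound \<delta> u a0 order_refl)
  also have "\<dots> = ?T * ((1 + u) ^ card R - 1)" using singular \<delta>(1) by (simp add: C_def)
  also have "\<dots> \<le> ?T * ((1 + u) ^ card N - 1)"
    using T0 u(1) card_mono[OF N R(1)] by (intro mult_left_mono diff_right_mono power_increasing) auto
  finally show ?thesis by (simp add: u_def)
qed

section \<open>Posterior weights of partitions\<close>

text \<open>Membership in \<open>ordered_partitions\<close> without extensionality, so that
  \<open>oracle_block\<close>, which is not restricted to \<open>{1..K}\<close>, qualifies.\<close>

definition is_partition :: "nat \<Rightarrow> nat \<Rightarrow> (nat \<Rightarrow> nat set) \<Rightarrow> bool" where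
  "is_partition n K V \<longleftrightarrow> (\<forall>k \<in> {1..K}. V k \<noteq> {}) \<and> disjoint_family_on V {1..K} \<and>
     (\<Union>k \<in> {1..K}. V k) = {1..n}"

lemma ordered_partitions_eq:
  "ordered_partitions n K = {V \<in> extensional {1..K}. is_partition n K V}"
  by (auto simp: ordered_partitions_def is_partition_def PiE_def)

lemma is_partitionD:
  assumes "is_partition n K V"
  shows "k \<in> {1..K} \<Longrightarrow> V k \<noteq> {}" "k \<in> {1..K} \<Longrightarrow> V k \<subseteq> {1..n}"
    and "k \<in> {1..K} \<Longrightarrow> finite (V k)" "i \<in> {1..n} \<Longrightarrow> \<exists>k\<in>{1..K}. i \<in> V k"
proof -
  show "k \<in> {1..K} \<Longrightarrow> V k \<noteq> {}" and sub: "k \<in> {1..K} \<Longrightarrow> V k \<subseteq> {1..n}"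
    and "i \<in> {1..n} \<Longrightarrow> \<exists>k\<in>{1..K}. i \<in> V k"
    using assms unfolding is_partition_def by blast+
  show "k \<in> {1..K} \<Longrightarrow> finite (V k)"
    using finite_subset[OF sub] by simp
qed

lemma block_label_eq:
  assumes V: "is_partition n K V" and k: "k \<in> {1..K}" "i \<in> V k"
  shows "block_label K V i = k"
  unfolding block_label_def
proof (rule the_equality)
  fix l assume l: "l \<in> {1..K} \<and> i \<in> V l"
  show "l = k"
  proof (rule ccontr)
    assume "l \<noteq> k"
    then have "V l \<inter> V k = {}"
      using V k l unfolding is_partition_def disjoint_family_on_def by blast
    then show False using l k by auto
  qed
qed (use k in simp)

lemma block_label_mem:
  assumes V: "is_partition n K V" and i: "i \<in> {1..n}"
  shows "block_label K V i \<in> {1..K}" "i \<in> V (block_label K V i)"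
proof -
  obtain k where "k \<in> {1..K}" "i \<in> V k" using is_partitionD(4)[OF V i] by blast
  then show "block_label K V i \<in> {1..K}" "i \<in> V (block_label K V i)"
    using block_label_eq[OF V] by auto
qed

lemma block_eq_cls:
  assumes V: "is_partition n K V" and k: "k \<in> {1..K}"
  shows "V k = label_class {1..n} (block_label K V) k"
proof
  have "V k \<subseteq> {1..n}" using is_partitionD(2)[OF V k] .
  then show "V k \<subseteq> label_class {1..n} (block_label K V) k" using block_label_eq[OF V k] by auto
  show "label_class {1..n} (block_label K V) k \<subseteq> V k" using block_label_mem(2)[OF V] by auto
qed

lemma block_label_image:
  assumes V: "is_partition n K V"
  shows "block_label K V ` {1..n} = {1..K}"
proof
  show "{1..K} \<subseteq> block_label K V ` {1..n}"
  proof
    fix k assume k: "k \<in> {1..K}"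
    then obtain i where "i \<in> V k" using is_partitionD(1)[OF V k] by blast
    then show "k \<in> block_label K V ` {1..n}" using block_eq_cls[OF V k] by auto
  qed
qed (use block_label_mem(1)[OF V] in auto)

text \<open>A partition is determined by its label function, and there are \<open>K ^ n\<close> of
  those.\<close>

lemma ordered_partitions_finite_card:
  "finite (ordered_partitions n K)" "card (ordered_partitions n K) \<le> K ^ n"
proof -
  let ?F = "\<lambda>V. restrict (block_label K V) {1..n}"
  have inj: "inj_on ?F (ordered_partitions n K)"
  proof (rule inj_onI)
    fix V W assume V: "V \<in> ordered_partitions n K" and W: "W \<in> ordered_partitions n K" and eq: "?F V = ?F W"
    have "V k = W k" if k: "k \<in> {1..K}" for k
    proof -
      have "block_label K V i = block_label K W i" if "i \<in> {1..n}" for i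
        using fun_cong[OF eq, of i] that by simp
      then show ?thesis
        using V W k by (auto simp: ordered_partitions_eq block_eq_cls[of n K])
    qed
    then show "V = W" using V W by (intro extensionalityI[of V "{1..K}"]) (auto simp: ordered_partitions_eq)
  qed
  have sub: "?F ` ordered_partitions n K \<subseteq> {1..n} \<rightarrow>\<^sub>E {1..K}"
    using block_label_mem(1)[of n K] by (auto simp: ordered_partitions_eq)
  have fin: "finite ({1..n} \<rightarrow>\<^sub>E {1..K})" by (intro finite_PiE) auto
  show "finite (ordered_partitions n K)"
    using inj sub fin by (metis finite_imageD finite_subset)
  have "card (ordered_partitions n K) \<le> card ({1..n} \<rightarrow>\<^sub>E {1..K})"
    using inj sub fin by (rule card_inj_on_le)
  then show "card (ordered_partitions n K) \<le> K ^ n" by (simp add: card_PiE)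
qed

section \<open>Hamming distance\<close>

text \<open>The bijections are arbitrary outside \<open>{1..K}\<close>, so there are infinitely
  many; \<open>Min\<close> is meaningful because the cardinalities are bounded by
  \<open>n\<close>.\<close>

lemma hamming_dist_le:
  assumes "bij_betw \<psi> {1..K} {1..K}"
  shows "hamming_dist n K U V \<le> card {i \<in> {1..n}. \<psi> (block_label K U i) \<noteq> block_label K V i}"
proof -
  let ?S = "{card {i \<in> {1..n}. \<psi> (block_label K U i) \<noteq> block_label K V i} | \<psi>. bij_betw \<psi> {1..K} {1..K}}"
  have "card {i \<in> {1..n}. P i} \<le> n" for P
  proof -
    have "card {i \<in> {1..n}. P i} \<le> card {1..n}" by (intro card_mono) auto
    then show ?thesis by simp
  qed
  then have "?S \<subseteq> {..n}" by auto
  then have "finite ?S" by (rule finite_subset) simp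
  then show ?thesis unfolding hamming_dist_def by (rule Min_le) (use assms in blast)
qed

lemma hamming_dist_le_n: "hamming_dist n K U V \<le> n"
proof -
  have "hamming_dist n K U V \<le> card {i \<in> {1..n}. id (block_label K U i) \<noteq> block_label K V i}"
    by (rule hamming_dist_le) (rule bij_betw_id)
  also have "\<dots> \<le> card {1..n}" by (intro card_mono) auto
  finally show ?thesis by simp
qed

text \<open>The labels of \<open>V\<close> are a function of those of \<open>U\<close>, onto a set
  of the same finite size, hence a bijection. Used in contraposition: a positive distance yields two
  points that \<open>U\<close> joins and \<open>V\<close> separates, as
  \<open>prod_tree_weight_le\<close> requires.\<close>

lemma hamming_dist_refinement:
  assumes U: "is_partition n K U" and V: "is_partition n K V"
    and ref: "\<And>s t. s \<in> {1..n} \<Longrightarrow> t \<in> {1..n} \<Longrightarrow> block_label K U s = block_label K U t \<Longrightarrow>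
      block_label K V s = block_label K V t"
  shows "hamming_dist n K U V = 0"
proof -
  define \<psi> where "\<psi> k = block_label K V (SOME i. i \<in> U k)" for k
  have \<psi>: "\<psi> (block_label K U i) = block_label K V i" if i: "i \<in> {1..n}" for i
  proof -
    let ?k = "block_label K U i"
    have k: "?k \<in> {1..K}" "i \<in> U ?k" using block_label_mem[OF U i] by auto
    then have "(SOME i. i \<in> U ?k) \<in> U ?k" by (intro someI[of "\<lambda>j. j \<in> U ?k"])
    then show ?thesis unfolding \<psi>_def using i block_eq_cls[OF U k(1)] by (intro ref) auto
  qed
  have "\<psi> ` {1..K} = {1..K}"
  proof -
    have "\<psi> ` {1..K} = \<psi> ` block_label K U ` {1..n}" using block_label_image[OF U] by simp
    also have "\<dots> = block_label K V ` {1..n}" using \<psi> by (simp add: image_image)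
    finally show ?thesis using block_label_image[OF V] by simp
  qed
  then have "bij_betw \<psi> {1..K} {1..K}"
    by (metis bij_betw_def eq_card_imp_inj_on finite_atLeastAtMost)
  then have "hamming_dist n K U V \<le> card {i \<in> {1..n}. \<psi> (block_label K U i) \<noteq> block_label K V i}"
    by (rule hamming_dist_le)
  also have "{i \<in> {1..n}. \<psi> (block_label K U i) \<noteq> block_label K V i} = {}" using \<psi> by auto
  finally show ?thesis by simp
qed

section \<open>Gaussian weights and the posterior\<close>

lemma euclid_dist_commute: "euclid_dist p x y = euclid_dist p y x"
  by (simp add: euclid_dist_def L2_set_def power2_commute)

lemma gaussian_weight_pos: "0 < \<sigma> \<Longrightarrow> 0 < gaussian_weight p \<sigma> x y"
  by (simp add: gaussian_weight_def)

lemma gaussian_weight_commute: "gaussian_weight p \<sigma> x y = gaussian_weight p \<sigma> y x"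
  by (simp add: gaussian_weight_def euclid_dist_commute[of p x])

lemma euclid_dist_nonneg: "0 \<le> euclid_dist p x y"
  by (simp add: euclid_dist_def L2_set_nonneg)

lemma bsf_weight_eq:
  assumes V: "is_partition n K V"
  shows "bsf_weight K r p \<sigma> y V = (\<Prod>k \<in> {1..K}. \<Sum>i \<in> V k. r (y i)) *
    (\<Prod>k \<in> {1..K}. tree_weight (\<lambda>s t. gaussian_weight p \<sigma> (y s) (y t)) (label_class {1..n} (block_label K V) k))"
  unfolding bsf_weight_def prod.distrib[symmetric]
proof (intro prod.cong refl)
  fix k assume k: "k \<in> {1..K}"
  have "V k \<noteq> {}" "finite (V k)" using is_partitionD(1,3)[OF V k] .
  then show "(\<Sum>i \<in> V k. r (y i)) * laplacian_minor (\<lambda>s t. gaussian_weight p \<sigma> (y s) (y t)) (V k) =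
     (\<Sum>i \<in> V k. r (y i)) *
     tree_weight (\<lambda>s t. gaussian_weight p \<sigma> (y s) (y t)) (label_class {1..n} (block_label K V) k)"
    unfolding block_eq_cls[OF V k, symmetric] tree_weight_def by (simp add: laplacian_minor_eq)
qed

lemma bsf_weight_pos:
  assumes V: "is_partition n K V" and \<sigma>: "0 < \<sigma>" and r: "\<And>i. i \<in> {1..n} \<Longrightarrow> 0 < r (y i)"
  shows "0 < bsf_weight K r p \<sigma> y V"
proof -
  have "0 < (\<Sum>i \<in> V k. r (y i))" if k: "k \<in> {1..K}" for k
  proof -
    have "V k \<noteq> {}" "V k \<subseteq> {1..n}" "finite (V k)" using is_partitionD(1-3)[OF V k] .
    then show "0 < (\<Sum>i \<in> V k. r (y i))" using r by (intro sum_pos) auto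
  qed
  then have "0 < (\<Prod>k \<in> {1..K}. \<Sum>i \<in> V k. r (y i))" by (intro prod_pos) auto
  moreover have "0 < (\<Prod>k \<in> {1..K}. tree_weight (\<lambda>s t. gaussian_weight p \<sigma> (y s) (y t)) (label_class {1..n} (block_label K V) k))"
    using block_label_image[OF V] \<sigma>
    by (intro prod_tree_weight_pos) (auto simp: gaussian_weight_pos gaussian_weight_commute)
  ultimately show ?thesis unfolding bsf_weight_eq[OF V] by (rule mult_pos_pos)
qed

lemma posterior_weight_sum:
  assumes "0 < \<sigma>" "\<And>i. i \<in> {1..n} \<Longrightarrow> 0 < r (y i)" "is_partition n K U"
  shows "0 < (\<Sum>W \<in> ordered_partitions n K. bsf_weight K r p \<sigma> y W)"
    and "bsf_weight K r p \<sigma> y U \<le> (\<Sum>W \<in> ordered_partitions n K. bsf_weight K r p \<sigma> y W)"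
proof -
  \<comment> \<open>Restriction makes \<open>U\<close> a term of the normalising sum without
    changing its weight.\<close>
  let ?U = "restrict U {1..K}"
  have U: "?U \<in> ordered_partitions n K"
    using assms(3) by (auto simp: ordered_partitions_eq is_partition_def disjoint_family_on_def)
  have eq: "bsf_weight K r p \<sigma> y ?U = bsf_weight K r p \<sigma> y U"
    by (simp add: bsf_weight_def)
  have pos: "0 < bsf_weight K r p \<sigma> y W" if "W \<in> ordered_partitions n K" for W
    using that assms by (intro bsf_weight_pos) (auto simp: ordered_partitions_eq)
  show "0 < (\<Sum>W \<in> ordered_partitions n K. bsf_weight K r p \<sigma> y W)"
    using U pos ordered_partitions_finite_card(1) by (intro sum_pos) auto
  show "bsf_weight K r p \<sigma> y U \<le> (\<Sum>W \<in> ordered_partitions n K. bsf_weight K r p \<sigma> y W)"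
    unfolding eq[symmetric] using ordered_partitions_finite_card(1)
    by (intro member_le_sum[OF U] less_imp_le[OF pos]) auto
qed

lemma posterior_expectation_le:
  assumes "0 < \<sigma>" "\<And>i. i \<in> {1..n} \<Longrightarrow> 0 < r (y i)" "is_partition n K U"
    and g: "\<And>V. is_partition n K V \<Longrightarrow> g V \<le> c"
  shows "posterior_expectation n K r p \<sigma> y g \<le> c"
proof -
  let ?Z = "\<Sum>W \<in> ordered_partitions n K. bsf_weight K r p \<sigma> y W"
  have Z: "0 < ?Z" using posterior_weight_sum(1)[of \<sigma> n r y K U p, OF assms(1-3)] .
  have "posterior_expectation n K r p \<sigma> y g \<le> (\<Sum>V \<in> ordered_partitions n K. bsf_posterior n K r p \<sigma> y V * c)"
    unfolding posterior_expectation_def bsf_posterior_def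
    using Z assms bsf_weight_pos[of n K _ \<sigma> r y p]
    by (intro sum_mono mult_left_mono) (auto simp: ordered_partitions_eq intro!: divide_nonneg_pos less_imp_le)
  also have "\<dots> = c"
    using Z by (simp add: bsf_posterior_def sum_distrib_right[symmetric] sum_divide_distrib[symmetric])
  finally show ?thesis .
qed

text \<open>Every partition at positive distance is compared with the oracle term of the normalising
  sum. \<open>K ^ n\<close> counts partitions, \<open>n\<close> bounds the distance, and
  \<open>(n * rb / ra) ^ K\<close> compares the root factors. The normalisation of the Gaussian
  weight cancels in the ratio of \<epsilon> to \<delta>.\<close>

lemma posterior_hamming_le:
  assumes U: "is_partition n K U" and \<sigma>: "0 < \<sigma>"
    and r: "0 < ra" "\<And>i. i \<in> {1..n} \<Longrightarrow> ra \<le> r (y i)" "\<And>i. i \<in> {1..n} \<Longrightarrow> r (y i) \<le> rb"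
    and near: "\<And>s t. s \<in> {1..n} \<Longrightarrow> t \<in> {1..n} \<Longrightarrow> block_label K U s = block_label K U t \<Longrightarrow>
      euclid_dist p (y s) (y t) \<le> d1"
    and far: "\<And>s t. s \<in> {1..n} \<Longrightarrow> t \<in> {1..n} \<Longrightarrow> block_label K U s \<noteq> block_label K U t \<Longrightarrow>
      d2 \<le> euclid_dist p (y s) (y t)" and d2: "0 \<le> d2"
  shows "posterior_expectation n K r p \<sigma> y (\<lambda>V. real (hamming_dist n K V U)) \<le>
    real K ^ n * (real n * (real n * rb / ra) ^ K *
      ((1 + real n * exp (- (d2\<^sup>2 - d1\<^sup>2) / (2 * \<sigma>\<^sup>2))) ^ n - 1))" (is "_ \<le> _ * (_ * ?c * ?E)")
proof -
  let ?f = "\<lambda>s t. gaussian_weight p \<sigma> (y s) (y t)"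
  let ?w = "bsf_weight K r p \<sigma> y"
  let ?T = "\<lambda>V. \<Prod>k \<in> {1..K}. tree_weight ?f (label_class {1..n} (block_label K V) k)"
  have rpos: "0 < r (y i)" if "i \<in> {1..n}" for i using r(1) r(2)[OF that] by linarith
  define \<zeta> where "\<zeta> = inverse ((sqrt (2 * pi) * \<sigma>) ^ p)"
  have \<zeta>: "0 < \<zeta>" using \<sigma> by (simp add: \<zeta>_def)
  define \<delta> where "\<delta> = \<zeta> * exp (- d1\<^sup>2 / (2 * \<sigma>\<^sup>2))"
  define \<epsilon> where "\<epsilon> = \<zeta> * exp (- d2\<^sup>2 / (2 * \<sigma>\<^sup>2))"
  have \<delta>: "0 < \<delta>" using \<zeta> by (simp add: \<delta>_def)
  have ratio: "\<epsilon> / \<delta> = exp (- (d2\<^sup>2 - d1\<^sup>2) / (2 * \<sigma>\<^sup>2))"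
    using \<zeta> by (simp add: \<epsilon>_def \<delta>_def exp_diff[symmetric] diff_divide_distrib)
  have fpos: "0 < ?f s t" for s t using \<sigma> by (rule gaussian_weight_pos)
  have f\<delta>: "\<delta> \<le> ?f s t" if "s \<in> {1..n}" "t \<in> {1..n}" "block_label K U s = block_label K U t" for s t
  proof -
    have "(euclid_dist p (y s) (y t))\<^sup>2 \<le> d1\<^sup>2"
      using near[OF that] euclid_dist_nonneg by (intro power_mono) auto
    then show ?thesis
      unfolding gaussian_weight_def \<delta>_def \<zeta>_def[symmetric] using \<zeta> \<sigma>
      by (intro mult_left_mono) (auto simp: divide_right_mono)
  qed
  have f\<epsilon>: "?f s t \<le> \<epsilon>" if "s \<in> {1..n}" "t \<in> {1..n}" "block_label K U s \<noteq> block_label K U t" for s t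
  proof -
    have "d2\<^sup>2 \<le> (euclid_dist p (y s) (y t))\<^sup>2"
      using far[OF that] d2 by (intro power_mono) auto
    then show ?thesis
      unfolding gaussian_weight_def \<epsilon>_def \<zeta>_def[symmetric] using \<zeta> \<sigma>
      by (intro mult_left_mono) (auto simp: divide_right_mono)
  qed
  have E0: "0 \<le> ?E" by simp
  have c0: "0 \<le> ?c"
  proof (cases "n = 0")
    case False
    then have "0 \<le> rb" using r(1) r(2)[of 1] r(3)[of 1] by simp
    then show ?thesis using r(1) by simp
  qed (use U block_label_image[OF U] in auto)
  have TU: "0 < ?T U"
    using block_label_image[OF U] fpos
    by (intro prod_tree_weight_pos) (auto simp: gaussian_weight_commute)
  have bound: "bsf_posterior n K r p \<sigma> y V * real (hamming_dist n K V U) \<le> real n * ?c * ?E"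
    if V: "V \<in> ordered_partitions n K" for V
  proof (cases "hamming_dist n K V U = 0")
    case True
    then show ?thesis using c0 E0 by simp
  next
    case False
    have V': "is_partition n K V" using V by (simp add: ordered_partitions_eq)
    obtain s t where st: "s \<in> {1..n}" "t \<in> {1..n}" "block_label K V s = block_label K V t"
      "block_label K U s \<noteq> block_label K U t"
      using hamming_dist_refinement[OF V' U] False by blast
    have "?T V \<le> ?T U * ((1 + real (card {1..n}) * \<epsilon> / \<delta>) ^ card {1..n} - 1)"
      using block_label_image[OF U] block_label_image[OF V'] \<delta>
      by (intro prod_tree_weight_le[OF _ _ _ _ fpos _ _ _ _ st] f\<delta> f\<epsilon> gaussian_weight_commute) auto
    then have T: "?T V \<le> ?T U * ?E" by (simp add: ratio times_divide_eq_right[symmetric] del: times_divide_eq_right)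
    have sub: "V k \<subseteq> {1..n}" "U k \<subseteq> {1..n}" "U k \<noteq> {}" if "k \<in> {1..K}" for k
      using is_partitionD(2)[OF V' that] is_partitionD(1,2)[OF U that] by auto
    have nn: "0 \<le> (\<Sum>i \<in> V k. r (y i))" if "k \<in> {1..K}" for k
      using sub(1)[OF that] by (intro sum_nonneg less_imp_le[OF rpos]) blast
    have V_r: "(\<Prod>k \<in> {1..K}. \<Sum>i \<in> V k. r (y i)) \<le> (real n * rb) ^ K"
    proof -
      have "(\<Prod>k \<in> {1..K}. \<Sum>i \<in> V k. r (y i)) \<le> (\<Prod>k \<in> {1..K}. real n * rb)"
      proof (intro prod_mono conjI)
        fix k assume k: "k \<in> {1..K}"
        show "0 \<le> (\<Sum>i \<in> V k. r (y i))" using nn[OF k] .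
        have "(\<Sum>i \<in> V k. r (y i)) \<le> (\<Sum>i \<in> {1..n}. r (y i))"
          using sub(1)[OF k] by (intro sum_mono2 less_imp_le[OF rpos]) auto
        also have "\<dots> \<le> (\<Sum>i \<in> {1..n}. rb)" using r by (intro sum_mono) auto
        finally show "(\<Sum>i \<in> V k. r (y i)) \<le> real n * rb" by simp
      qed
      then show ?thesis by simp
    qed
    have U_r: "ra ^ K \<le> (\<Prod>k \<in> {1..K}. \<Sum>i \<in> U k. r (y i))"
    proof -
      have "(\<Prod>k \<in> {1..K}. ra) \<le> (\<Prod>k \<in> {1..K}. \<Sum>i \<in> U k. r (y i))"
      proof (intro prod_mono conjI)
        fix k assume k: "k \<in> {1..K}"
        obtain i where i: "i \<in> U k" using sub[OF k] by auto
        have "ra \<le> r (y i)" using i sub[OF k] r(2) by auto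
        also have "\<dots> \<le> (\<Sum>i \<in> U k. r (y i))"
          using sub(2)[OF k] finite_subset[OF sub(2)[OF k]] by (intro member_le_sum i less_imp_le[OF rpos]) auto
        finally show "ra \<le> (\<Sum>i \<in> U k. r (y i))" .
      qed (use r in simp)
      then show ?thesis by simp
    qed
    have "0 \<le> (\<Prod>k \<in> {1..K}. \<Sum>i \<in> V k. r (y i))" using nn by (intro prod_nonneg) auto
    then have nrb: "0 \<le> (real n * rb) ^ K" using V_r by linarith
    have TV: "0 \<le> ?T V" using fpos by (intro prod_nonneg ballI tree_weight_nonneg) (auto intro: less_imp_le)
    have "?w V \<le> (real n * rb) ^ K * (?T U * ?E)"
      unfolding bsf_weight_eq[OF V'] using nrb TV V_r T by (intro mult_mono)
    also have "\<dots> = ?c * ?E * (ra ^ K * ?T U)" using r(1) by (simp add: power_divide)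
    also have "\<dots> \<le> ?c * ?E * ?w U"
      unfolding bsf_weight_eq[OF U] using U_r TU c0 E0 by (intro mult_left_mono mult_right_mono) auto
    also have "\<dots> \<le> ?c * ?E * (\<Sum>W \<in> ordered_partitions n K. ?w W)"
      using posterior_weight_sum(2)[of \<sigma> n r y K U p, OF \<sigma> rpos U] c0 E0 by (intro mult_left_mono) auto
    finally have "bsf_posterior n K r p \<sigma> y V \<le> ?c * ?E"
      unfolding bsf_posterior_def using posterior_weight_sum(1)[of \<sigma> n r y K U p, OF \<sigma> rpos U]
      by (simp add: pos_divide_le_eq)
    then have "bsf_posterior n K r p \<sigma> y V * real (hamming_dist n K V U) \<le> ?c * ?E * real n"
      using hamming_dist_le_n[of n K V U] c0 E0 by (intro mult_mono) auto
    then show ?thesis by (simp add: mult.commute mult.left_commute)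
  qed
  have "posterior_expectation n K r p \<sigma> y (\<lambda>V. real (hamming_dist n K V U)) \<le>
      real (card (ordered_partitions n K)) * (real n * ?c * ?E)"
    unfolding posterior_expectation_def using bound by (rule sum_bounded_above)
  also have "\<dots> \<le> real K ^ n * (real n * ?c * ?E)"
    using ordered_partitions_finite_card(2)[of n K] c0 E0
    by (intro mult_right_mono) (simp_all flip: of_nat_power)
  finally show ?thesis .
qed

section \<open>Gaussian tails\<close>

text \<open>The first-order condition at a minimum, used below to identify a minimiser of the
  Rayleigh quotient as an eigenvector.\<close>

lemma quadratic_nonneg_imp_linear_zero:
  fixes c d :: real
  assumes "\<And>t. 0 \<le> 2 * c * t + d * t\<^sup>2"
  shows "c = 0"
proof -
  have "0 \<le> 2 * c * 1 + d * 1\<^sup>2" "0 \<le> 2 * c * (-1) + d * (-1)\<^sup>2" by (rule assms)+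
  then have d: "0 \<le> d" by simp
  \<comment> \<open>The test point \<open>- c / (1 + d)\<close> also makes sense for
    \<open>d = 0\<close>, where the vertex \<open>- c / d\<close> does not.\<close>
  define s where "s = c / (1 + d)"
  have c: "c = (1 + d) * s" using d by (simp add: s_def)
  have "2 * c * (- s) + d * (- s)\<^sup>2 = - ((2 + d) * s\<^sup>2)"
    unfolding c by (simp add: algebra_simps power2_eq_square)
  then have "(2 + d) * s\<^sup>2 \<le> 0" using assms[of "- s"] by linarith
  then have "s = 0" using d by (simp add: mult_le_0_iff)
  then show ?thesis using c by simp
qed

text \<open>A minimiser of the quadratic form on the unit sphere is an eigenvector. The dimension is
  a variable, so vectors are functions on \<open>nat\<close> and compactness is taken in the product
  topology.\<close>

lemma rayleigh_minimum:
  fixes B :: "nat \<Rightarrow> nat \<Rightarrow> real"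
  assumes p: "p \<ge> 1" and sym: "\<And>i j. B i j = B j i"
  obtains u m where "(\<Sum>i<p. (u i)\<^sup>2) = 1" "\<And>i. i < p \<Longrightarrow> (\<Sum>j<p. B i j * u j) = m * u i"
    "\<And>x. m * (\<Sum>i<p. (x i)\<^sup>2) \<le> (\<Sum>i<p. \<Sum>j<p. B i j * x i * x j)"
proof -
  define q where "q x = (\<Sum>i<p. \<Sum>j<p. B i j * x i * x j)" for x :: "nat \<Rightarrow> real"
  define nn where "nn x = (\<Sum>i<p. (x i)\<^sup>2)" for x :: "nat \<Rightarrow> real"
  \<comment> \<open>Freezing the coordinates from \<open>p\<close> on at 0 makes this a product of
    compact sets; \<open>q\<close> and \<open>nn\<close> only read the coordinates below
    \<open>p\<close>.\<close>
  define box where "box = (PiE UNIV (\<lambda>i. if i < p then {-1..1} else {0}) :: (nat \<Rightarrow> real) set)"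
  define S where "S = box \<inter> {x. nn x = 1}"
  have coord: "continuous_on UNIV (\<lambda>x :: nat \<Rightarrow> real. x i)" for i
    by (rule continuous_on_product_coordinates)
  have contn: "continuous_on UNIV nn" and contq: "continuous_on UNIV q"
    unfolding nn_def q_def by (intro continuous_intros coord)+
  have "compactin (product_topology (\<lambda>i::nat. euclideanreal) UNIV) box"
    unfolding box_def by (subst compactin_PiE) auto
  then have "compact box" by (simp add: euclidean_product_topology)
  moreover have "closed {x. nn x = 1}" using contn by (intro closed_Collect_eq) auto
  ultimately have "compact S" unfolding S_def by (rule compact_Int_closed)
  moreover have "(\<lambda>i. if i = 0 then 1 else 0) \<in> S"
    using p by (auto simp: S_def box_def nn_def if_distrib[of "\<lambda>x. x\<^sup>2"] cong: if_cong)
  then have "S \<noteq> {}" by blast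
  ultimately obtain u where u: "u \<in> S" "\<And>x. x \<in> S \<Longrightarrow> q u \<le> q x"
    using continuous_attains_inf[of S q] continuous_on_subset[OF contq] by blast
  define m where "m = q u"
  have nu: "nn u = 1" using u by (simp add: S_def)
  have q_scale: "q (\<lambda>i. c * x i) = c\<^sup>2 * q x" and n_scale: "nn (\<lambda>i. c * x i) = c\<^sup>2 * nn x" for c x
    by (simp_all add: q_def nn_def sum_distrib_left power2_eq_square algebra_simps)
  have min: "m * nn x \<le> q x" for x
  proof (cases "nn x = 0")
    case True
    then have "x i = 0" if "i < p" for i
      using that by (auto simp: nn_def sum_nonneg_eq_0_iff)
    then have "q x = 0" by (simp add: q_def)
    then show ?thesis using True by simp
  next
    case False
    have "0 \<le> nn x" by (simp add: nn_def sum_nonneg)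
    then have pos: "0 < nn x" using False by simp
    define c where "c = 1 / sqrt (nn x)"
    define z where "z i = (if i < p then c * x i else 0)" for i
    have c2: "c\<^sup>2 = 1 / nn x" using pos by (simp add: c_def power_divide)
    have "nn z = nn (\<lambda>i. c * x i)" and qz: "q z = q (\<lambda>i. c * x i)" by (simp_all add: nn_def q_def z_def)
    then have nz: "nn z = 1" using pos by (simp add: n_scale c2)
    have "z \<in> box"
    proof -
      have "\<bar>z i\<bar> \<le> 1" if "i < p" for i
      proof -
        have "(z i)\<^sup>2 \<le> nn z" unfolding nn_def using that by (intro member_le_sum) auto
        then show ?thesis using nz by (simp add: abs_square_le_1)
      qed
      then show ?thesis by (auto simp: box_def z_def abs_le_iff minus_le_iff)
    qed
    then have "m \<le> q z" using nz u(2) by (simp add: m_def S_def)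
    then show ?thesis using pos by (simp add: qz q_scale c2 field_simps)
  qed
  have eig: "(\<Sum>j<p. B i j * u j) = m * u i" if i: "i < p" for i
  proof -
    \<comment> \<open>Moving the minimiser along this unit vector gives a nonnegative quadratic in
      \<open>t\<close> with linear coefficient \<open>2 * c\<close>, where \<open>c\<close> is the
      entry of \<open>B u - m u\<close> at \<open>i\<close>.\<close>
    define e where "e j = (if j = i then 1 else 0 :: real)" for j
    define c where "c = (\<Sum>j<p. B i j * u j) - m * u i"
    have e_sum: "(\<Sum>j<p. e j * g j) = g i" for g
      using i by (simp add: e_def if_distrib[of "\<lambda>x. x * _"] cong: if_cong)
    have "0 \<le> 2 * c * t + (q e - m * nn e) * t\<^sup>2" for t
    proof -
      have "q (\<lambda>j. u j + t * e j) = q u + t * (\<Sum>i<p. \<Sum>j<p. B i j * e i * u j)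
          + t * (\<Sum>i<p. \<Sum>j<p. B i j * u i * e j) + t\<^sup>2 * q e"
        by (simp add: q_def algebra_simps sum.distrib sum_distrib_left power2_eq_square)
      also have "(\<Sum>i<p. \<Sum>j<p. B i j * u i * e j) = (\<Sum>j<p. \<Sum>i<p. B j i * e j * u i)"
        by (subst sum.swap, intro sum.cong refl) (metis sym mult.assoc mult.commute)
      also have "(\<Sum>i<p. \<Sum>j<p. B i j * e i * u j) = (\<Sum>i<p. e i * (\<Sum>j<p. B i j * u j))"
        by (simp add: sum_distrib_left algebra_simps)
      finally have qe: "q (\<lambda>j. u j + t * e j) = m + 2 * t * (\<Sum>j<p. B i j * u j) + t\<^sup>2 * q e"
        by (simp add: e_sum m_def)
      have "nn (\<lambda>j. u j + t * e j) = nn u + 2 * t * (\<Sum>j<p. e j * u j) + t\<^sup>2 * nn e"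
        by (simp add: nn_def power2_eq_square algebra_simps sum.distrib sum_distrib_left)
      then have ne: "nn (\<lambda>j. u j + t * e j) = 1 + 2 * t * u i + t\<^sup>2 * nn e"
        by (simp add: nu e_sum)
      show ?thesis using min[of "\<lambda>j. u j + t * e j"] unfolding qe ne c_def
        by (simp add: algebra_simps)
    qed
    then have "c = 0" by (rule quadratic_nonneg_imp_linear_zero)
    then show ?thesis by (simp add: c_def)
  qed
  show ?thesis by (rule that[of u m]) (use nu eig min in \<open>auto simp: nn_def q_def\<close>)
qed

lemma positive_definite_inverse:
  assumes A: "positive_definite p A"
  obtains B where "mat_inverse A = Some B" "B \<in> carrier_mat p p" "A * B = 1\<^sub>m p" "B * A = 1\<^sub>m p"
    "transpose_mat B = B"
proof -
  have car: "A \<in> carrier_mat p p" and symA: "transpose_mat A = A"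
    and pd: "\<And>v. v \<in> carrier_vec p \<Longrightarrow> v \<noteq> 0\<^sub>v p \<Longrightarrow> 0 < scalar_prod v (A *\<^sub>v v)"
    using A by (auto simp: positive_definite_def)
  have "Determinant.det A \<noteq> 0"
  proof
    assume "Determinant.det A = 0"
    then obtain v where "v \<in> carrier_vec p" "v \<noteq> 0\<^sub>v p" "A *\<^sub>v v = 0\<^sub>v p"
      using det_0_iff_vec_prod_zero_field[OF car] by blast
    then show False using pd[of v] by simp
  qed
  then have "A \<in> Units (ring_mat TYPE(real) p p)" by (rule det_non_zero_imp_unit[OF car])
  then obtain B where inv: "mat_inverse A = Some B" using mat_inverse(1)[OF car] by fastforce
  then have B: "A * B = 1\<^sub>m p" "B * A = 1\<^sub>m p" "B \<in> carrier_mat p p"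
    using mat_inverse(2)[OF car] by auto
  have "transpose_mat B * A = 1\<^sub>m p"
    using transpose_mult[OF car B(3)] B(1) symA by simp
  then have "transpose_mat B * A * B = B" using B(3) by simp
  moreover have "transpose_mat B * A * B = transpose_mat B * (A * B)"
    using B(3) car by (intro assoc_mult_mat[of _ p p _ p _ p]) auto
  ultimately have "transpose_mat B = B" using B by simp
  then show ?thesis using that inv B by blast
qed

text \<open>The minimum \<open>m\<close> of the Rayleigh quotient of the inverse is an eigenvalue of
  the inverse, so \<open>1 / m\<close> is an eigenvalue of \<open>A\<close>. Hence
  \<open>1 / m \<le> lambda_max A\<close>, which is the lower bound wanted for
  \<open>m\<close>.\<close>

lemma inverse_quadratic_form_ge:
  assumes A: "positive_definite p A" and p: "p \<ge> 1"
  shows "0 < lambda_max A"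
    and "v \<in> carrier_vec p \<Longrightarrow> scalar_prod v v / lambda_max A \<le> scalar_prod v (the (mat_inverse A) *\<^sub>v v)"
proof -
  have car: "A \<in> carrier_mat p p"
    and pd: "\<And>v. v \<in> carrier_vec p \<Longrightarrow> v \<noteq> 0\<^sub>v p \<Longrightarrow> 0 < scalar_prod v (A *\<^sub>v v)"
    using A by (auto simp: positive_definite_def)
  obtain B where B: "mat_inverse A = Some B" "B \<in> carrier_mat p p" "A * B = 1\<^sub>m p" "B * A = 1\<^sub>m p"
    "transpose_mat B = B" using positive_definite_inverse[OF A] .
  \<comment> \<open>Padding with zeros makes the symmetry hold for all indices, as
    \<open>rayleigh_minimum\<close> demands.\<close>
  define b where "b i j = (if i < p \<and> j < p then B $$ (i, j) else 0)" for i j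
  have "b i j = b j i" for i j
  proof (cases "i < p \<and> j < p")
    case True
    have "transpose_mat B $$ (i, j) = B $$ (j, i)" using True B(2) by simp
    then show ?thesis using True B(5) by (simp add: b_def)
  qed (auto simp: b_def)
  then obtain u m where u: "(\<Sum>i<p. (u i)\<^sup>2) = 1" "\<And>i. i < p \<Longrightarrow> (\<Sum>j<p. b i j * u j) = m * u i"
    "\<And>x. m * (\<Sum>i<p. (x i)\<^sup>2) \<le> (\<Sum>i<p. \<Sum>j<p. b i j * x i * x j)"
    using rayleigh_minimum[OF p] by blast
  define w where "w = Matrix.vec p u"
  have w: "w \<in> carrier_vec p" by (simp add: w_def)
  have ww: "scalar_prod w w = 1"
    using u(1) by (simp add: w_def scalar_prod_def power2_eq_square lessThan_atLeast0)
  then have w0: "w \<noteq> 0\<^sub>v p" by auto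
  have Bw: "B *\<^sub>v w = m \<cdot>\<^sub>v w"
  proof (rule eq_vecI)
    fix i assume "i < dim_vec (m \<cdot>\<^sub>v w)"
    then have i: "i < p" by (simp add: w_def)
    then show "(B *\<^sub>v w) $ i = (m \<cdot>\<^sub>v w) $ i"
      using B(2) u(2)[OF i] by (simp add: w_def mult_mat_vec_def scalar_prod_def b_def lessThan_atLeast0)
  qed (use B(2) in \<open>simp add: w_def\<close>)
  have "w = A *\<^sub>v (B *\<^sub>v w)"
    using assoc_mult_mat_vec[OF car B(2) w] B(3) w by simp
  also have "\<dots> = m \<cdot>\<^sub>v (A *\<^sub>v w)"
    unfolding Bw using car w by (rule mult_mat_vec)
  finally have wA: "w = m \<cdot>\<^sub>v (A *\<^sub>v w)" .
  have "1 = scalar_prod w (m \<cdot>\<^sub>v (A *\<^sub>v w))" using ww wA by simp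
  also have "\<dots> = m * scalar_prod w (A *\<^sub>v w)"
    using car w by (intro scalar_prod_smult_right) auto
  finally have m1: "m * scalar_prod w (A *\<^sub>v w) = 1" by simp
  have "0 < m * scalar_prod w (A *\<^sub>v w)" unfolding m1 by simp
  then have m: "0 < m" using pd[OF w w0] by (auto simp: zero_less_mult_iff)
  have "(1 / m) \<cdot>\<^sub>v w = (1 / m) \<cdot>\<^sub>v (m \<cdot>\<^sub>v (A *\<^sub>v w))" using wA by simp
  also have "\<dots> = A *\<^sub>v w" using m by (simp add: smult_smult_assoc)
  finally have "eigenvalue A (1 / m)"
    unfolding eigenvalue_def eigenvector_def using w w0 car by (intro exI[of _ w]) auto
  moreover have "finite {l. eigenvalue A l}"
    unfolding eigenvalue_root_char_poly[OF car]
    using degree_monic_char_poly[OF car] by (intro poly_roots_finite) auto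
  ultimately have le: "1 / m \<le> lambda_max A" unfolding lambda_max_def by (intro Max_ge) auto
  moreover have "0 < 1 / m" using m by simp
  ultimately show pos: "0 < lambda_max A" by linarith
  show "scalar_prod v v / lambda_max A \<le> scalar_prod v (the (mat_inverse A) *\<^sub>v v)"
    if v: "v \<in> carrier_vec p"
  proof -
    have vv: "scalar_prod v v = (\<Sum>i<p. (v $ i)\<^sup>2)"
      using v by (simp add: scalar_prod_def power2_eq_square lessThan_atLeast0)
    have "scalar_prod v v / lambda_max A \<le> m * (\<Sum>i<p. (v $ i)\<^sup>2)"
    proof -
      have "1 / lambda_max A \<le> m" using le m pos by (simp add: field_simps)
      then have "1 / lambda_max A * (\<Sum>i<p. (v $ i)\<^sup>2) \<le> m * (\<Sum>i<p. (v $ i)\<^sup>2)"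
        by (intro mult_right_mono sum_nonneg) auto
      then show ?thesis unfolding vv by simp
    qed
    also have "\<dots> \<le> (\<Sum>i<p. \<Sum>j<p. b i j * v $ i * v $ j)" by (rule u(3))
    also have "\<dots> = scalar_prod v (B *\<^sub>v v)"
      using v B(2) by (simp add: scalar_prod_def b_def lessThan_atLeast0 sum_distrib_left algebra_simps)
    finally show ?thesis using B(1) by simp
  qed
qed

section \<open>Change of variables and the tail of a Gaussian vector\<close>

text \<open>Fubini reduces the claim to the affine substitution on the line, one coordinate at a
  time; the restriction keeps the transformed point in the product space.\<close>

lemma nn_integral_PiM_lborel_affine:
  fixes t :: "'i \<Rightarrow> real"
  assumes "finite I" and c: "c > 0"
    and "f \<in> borel_measurable (PiM I (\<lambda>_. lborel))"
  shows "integral\<^sup>N (PiM I (\<lambda>_. lborel)) f =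
    ennreal (c ^ card I) * (\<integral>\<^sup>+x. f (\<lambda>i\<in>I. t i + c * x i) \<partial>PiM I (\<lambda>_. lborel))"
  using assms(1,3)
proof (induction I arbitrary: f rule: finite_induct)
  case empty
  interpret product_sigma_finite "\<lambda>_. lborel :: real measure" ..
  show ?case by (simp add: PiM_empty nn_integral_count_space_finite)
next
  case (insert i I)
  interpret product_sigma_finite "\<lambda>_. lborel :: real measure" ..
  let ?P = "PiM I (\<lambda>_. lborel :: real measure)"
  note [measurable] = insert.prems
  let ?T = "\<lambda>J x. \<lambda>i\<in>J. t i + c * x i"
  have T [measurable]: "?T J \<in> measurable (PiM J (\<lambda>_. lborel)) (PiM J (\<lambda>_. lborel))" for J
    by (intro measurable_restrict) auto
  have F: "(\<lambda>x. \<integral>\<^sup>+y. g (x(i := y)) \<partial>lborel) \<in> borel_measurable ?P"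
    if [measurable]: "g \<in> borel_measurable (PiM (insert i I) (\<lambda>_. lborel))" for g :: "('i \<Rightarrow> real) \<Rightarrow> ennreal"
    using insert.hyps by measurable
  have fT: "(\<lambda>x. f (?T (insert i I) x)) \<in> borel_measurable (PiM (insert i I) (\<lambda>_. lborel))"
    by (rule measurable_compose[OF T insert.prems])
  have "integral\<^sup>N (PiM (insert i I) (\<lambda>_. lborel)) f = (\<integral>\<^sup>+x. \<integral>\<^sup>+y. f (x(i := y)) \<partial>lborel \<partial>?P)"
    using insert by (intro product_nn_integral_insert) auto
  also have "\<dots> = ennreal (c ^ card I) * (\<integral>\<^sup>+x. \<integral>\<^sup>+y. f ((?T I x)(i := y)) \<partial>lborel \<partial>?P)"
    by (rule insert.IH[OF F[OF insert.prems]])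
  also have "(\<integral>\<^sup>+x. \<integral>\<^sup>+y. f ((?T I x)(i := y)) \<partial>lborel \<partial>?P) =
      (\<integral>\<^sup>+x. ennreal c * \<integral>\<^sup>+y. f (?T (insert i I) (x(i := y))) \<partial>lborel \<partial>?P)"
  proof (intro nn_integral_cong)
    fix x assume x: "x \<in> space ?P"
    have Tx: "?T I x \<in> space ?P" using measurable_space[OF T x] .
    have [measurable]: "(\<lambda>y. f ((?T I x)(i := y))) \<in> borel_measurable borel"
      using measurable_compose[OF measurable_component_update[OF Tx insert.hyps(2)] insert.prems] by simp
    have "(\<integral>\<^sup>+y. f ((?T I x)(i := y)) \<partial>lborel) =
        ennreal \<bar>c\<bar> * (\<integral>\<^sup>+y. f ((?T I x)(i := t i + c * y)) \<partial>lborel)"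
      using c by (intro nn_integral_real_affine) auto
    also have "(\<lambda>y. (?T I x)(i := t i + c * y)) = (\<lambda>y. ?T (insert i I) (x(i := y)))"
      using insert.hyps by (auto simp: fun_eq_iff)
    then have "(\<integral>\<^sup>+y. f ((?T I x)(i := t i + c * y)) \<partial>lborel) =
        (\<integral>\<^sup>+y. f (?T (insert i I) (x(i := y))) \<partial>lborel)"
      by (intro nn_integral_cong arg_cong[of _ _ f]) (rule fun_cong)
    finally show "(\<integral>\<^sup>+y. f ((?T I x)(i := y)) \<partial>lborel) =
        ennreal c * (\<integral>\<^sup>+y. f (?T (insert i I) (x(i := y))) \<partial>lborel)"
      unfolding abs_of_pos[OF c] .
  qed
  also have "\<dots> = ennreal c * (\<integral>\<^sup>+x. \<integral>\<^sup>+y. f (?T (insert i I) (x(i := y))) \<partial>lborel \<partial>?P)"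
    by (rule nn_integral_cmult[OF F[OF fT]])
  also have "(\<integral>\<^sup>+x. \<integral>\<^sup>+y. f (?T (insert i I) (x(i := y))) \<partial>lborel \<partial>?P) =
      (\<integral>\<^sup>+x. f (?T (insert i I) x) \<partial>PiM (insert i I) (\<lambda>_. lborel))"
    using insert.hyps fT by (intro product_nn_integral_insert[symmetric]) auto
  finally have eq: "integral\<^sup>N (PiM (insert i I) (\<lambda>_. lborel)) f = ennreal (c ^ card I) *
    (ennreal c * (\<integral>\<^sup>+x. f (?T (insert i I) x) \<partial>PiM (insert i I) (\<lambda>_. lborel)))" .
  have "ennreal (c ^ card (insert i I)) = ennreal (c ^ card I) * ennreal c"
    using insert.hyps c by (simp add: ennreal_mult mult.commute)
  then show ?case unfolding eq by (simp only: mult.assoc)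
qed

lemma euclid_dist_measurable:
  "(\<lambda>x. euclid_dist p x m) \<in> borel_measurable (PiM {..<p} (\<lambda>_. lborel))"
  unfolding euclid_dist_def L2_set_def by measurable

text \<open>Half of the exponent controls the tail; the other half is the density contracted towards the
  mean by \<open>1 / sqrt 2\<close>, whose integral is known by a coordinatewise change of variables.\<close>

lemma mvn_density_tail:
  assumes A: "positive_definite p A" and p: "p \<ge> 1" and t: "0 \<le> t" "t \<le> euclid_dist p x m"
    and L: "lambda_max A \<le> L"
  shows "ennreal (mvn_density p m A x) \<le> ennreal (exp (- t\<^sup>2 / (4 * L))) *
    ennreal (mvn_density p m A (\<lambda>j\<in>{..<p}. (1 - 1 / sqrt 2) * m j + 1 / sqrt 2 * x j))"
proof -
  define B where "B = the (mat_inverse A)"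
  define v where "v = Matrix.vec p (\<lambda>j. x j - m j)"
  define Z where "Z = sqrt ((2 * pi) ^ p * Determinant.det A)"
  define q where "q = scalar_prod v (B *\<^sub>v v)"
  obtain B' where "mat_inverse A = Some B'" "B' \<in> carrier_mat p p" 
    using positive_definite_inverse[OF A] by blast
  then have B: "B \<in> carrier_mat p p" by (simp add: B_def)
  have v: "v \<in> carrier_vec p" by (simp add: v_def)
  have "Matrix.vec p (\<lambda>j. (\<lambda>j\<in>{..<p}. (1 - 1 / sqrt 2) * m j + 1 / sqrt 2 * x j) j - m j) = (1 / sqrt 2) \<cdot>\<^sub>v v"
    by (intro eq_vecI) (auto simp: v_def algebra_simps diff_divide_distrib)
  moreover have "scalar_prod ((1 / sqrt 2) \<cdot>\<^sub>v v) (B *\<^sub>v ((1 / sqrt 2) \<cdot>\<^sub>v v)) = q / 2"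
  proof -
    have "B *\<^sub>v ((1 / sqrt 2) \<cdot>\<^sub>v v) = (1 / sqrt 2) \<cdot>\<^sub>v (B *\<^sub>v v)"
      using mult_mat_vec[OF B v] .
    moreover have "scalar_prod ((1 / sqrt 2) \<cdot>\<^sub>v v) ((1 / sqrt 2) \<cdot>\<^sub>v (B *\<^sub>v v)) =
        1 / sqrt 2 * (1 / sqrt 2 * q)"
      using v B by (simp add: q_def)
    ultimately show ?thesis by (simp add: field_simps)
  qed
  ultimately have scaled: "mvn_density p m A (\<lambda>j\<in>{..<p}. (1 - 1 / sqrt 2) * m j + 1 / sqrt 2 * x j) =
      exp (- q / 4) / Z"
    by (simp add: mvn_density_def Let_def B_def[symmetric] Z_def)
  have orig: "mvn_density p m A x = exp (- q / 4) * exp (- q / 4) / Z"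
    by (simp add: mvn_density_def Let_def B_def[symmetric] Z_def v_def[symmetric] q_def exp_add[symmetric])
  have tv: "t\<^sup>2 \<le> scalar_prod v v"
  proof -
    have "t\<^sup>2 \<le> (euclid_dist p x m)\<^sup>2" using t by (intro power_mono) auto
    also have "\<dots> = scalar_prod v v"
      by (simp add: euclid_dist_def L2_set_def sum_nonneg scalar_prod_def v_def power2_eq_square lessThan_atLeast0)
    finally show ?thesis .
  qed
  have "t\<^sup>2 / L \<le> scalar_prod v v / lambda_max A"
    using tv order_trans[OF zero_le_power2 tv] L inverse_quadratic_form_ge(1)[OF A p]
    by (intro frac_le) auto
  also have "\<dots> \<le> q" unfolding q_def B_def using inverse_quadratic_form_ge(2)[OF A p v] .
  finally have "exp (- q / 4) \<le> exp (- t\<^sup>2 / (4 * L))" by (simp add: field_simps)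
  then show ?thesis
  \<comment> \<open>The sign of the determinant is left open: if \<open>Z\<close> is not positive,
    the density is at most 0 and \<open>ennreal\<close> truncates it to 0.\<close>
  proof (cases "Z > 0")
    case True
    then show ?thesis unfolding orig scaled
      using \<open>exp (- q / 4) \<le> exp (- t\<^sup>2 / (4 * L))\<close>
      by (simp add: ennreal_mult[symmetric] divide_right_mono mult_right_mono)
  next
    case False
    then have "mvn_density p m A x \<le> 0" unfolding orig by (intro divide_nonneg_nonpos) auto
    then show ?thesis by (simp add: ennreal_neg)
  qed
qed

text \<open>Total mass 1 of the density is read off from \<open>distributed\<close>. The contraction
  has Jacobian \<open>(1 / sqrt 2) ^ p\<close>, so the contracted density integrates to
  \<open>sqrt 2 ^ p\<close>.\<close>

lemma gaussian_tail:
  assumes M: "prob_space M" and A: "positive_definite p A" and p: "p \<ge> 1"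
    and X: "distributed M (PiM {..<p} (\<lambda>_. lborel)) X (\<lambda>x. ennreal (mvn_density p m A x))"
    and t: "0 \<le> t" and L: "lambda_max A \<le> L"
  shows "{\<omega> \<in> space M. t < euclid_dist p (X \<omega>) m} \<in> sets M"
    and "measure M {\<omega> \<in> space M. t < euclid_dist p (X \<omega>) m} \<le> sqrt 2 ^ p * exp (- t\<^sup>2 / (4 * L))"
proof -
  interpret prob_space M by (rule M)
  let ?P = "PiM {..<p} (\<lambda>_. lborel :: real measure)"
  let ?f = "\<lambda>x. ennreal (mvn_density p m A x)"
  let ?T = "\<lambda>x. \<lambda>j\<in>{..<p}. (1 - 1 / sqrt 2) * m j + 1 / sqrt 2 * x j"
  let ?E = "{\<omega> \<in> space M. t < euclid_dist p (X \<omega>) m}"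
  define S where "S = {x \<in> space ?P. t < euclid_dist p x m}"
  note [measurable] = euclid_dist_measurable[of p m]
  have X' [measurable]: "X \<in> measurable M ?P" using X by (rule distributed_measurable)
  have f [measurable]: "?f \<in> borel_measurable ?P" using X by (rule distributed_borel_measurable)
  have S: "S \<in> sets ?P" unfolding S_def by measurable
  show "?E \<in> sets M" by measurable
  have E: "?E = X -` S \<inter> space M" using measurable_space[OF X'] by (auto simp: S_def)
  have T [measurable]: "?T \<in> measurable ?P ?P" by (intro measurable_restrict) auto
  have "integral\<^sup>N ?P ?f = emeasure M (X -` space ?P \<inter> space M)"
    using distributed_emeasure[OF X sets.top]
    by (auto simp: intro!: nn_integral_cong split: split_indicator)
  also have "\<dots> = 1"
    using measurable_space[OF X'] emeasure_space_1 by (auto simp: Int_absorb1 subset_eq vimage_def)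
  finally have "ennreal ((1 / sqrt 2) ^ p) * (\<integral>\<^sup>+x. ?f (?T x) \<partial>?P) = 1"
    using nn_integral_PiM_lborel_affine[of "{..<p}" "1 / sqrt 2" ?f "\<lambda>j. (1 - 1 / sqrt 2) * m j", OF _ _ f]
    by simp
  then have "ennreal (sqrt 2 ^ p) * (ennreal ((1 / sqrt 2) ^ p) * (\<integral>\<^sup>+x. ?f (?T x) \<partial>?P)) = ennreal (sqrt 2 ^ p)"
    by simp
  then have Tint: "(\<integral>\<^sup>+x. ?f (?T x) \<partial>?P) = ennreal (sqrt 2 ^ p)"
    by (simp add: mult.assoc[symmetric] ennreal_mult[symmetric] power_mult_distrib[symmetric])
  have "emeasure M ?E = (\<integral>\<^sup>+x. ?f x * indicator S x \<partial>?P)"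
    unfolding E by (rule distributed_emeasure[OF X S])
  also have "\<dots> \<le> (\<integral>\<^sup>+x. ennreal (exp (- t\<^sup>2 / (4 * L))) * ?f (?T x) \<partial>?P)"
    using mvn_density_tail[OF A p t _ L, of _ m]
    by (intro nn_integral_mono) (auto simp: S_def split: split_indicator)
  also have "\<dots> = ennreal (exp (- t\<^sup>2 / (4 * L))) * ennreal (sqrt 2 ^ p)"
    unfolding Tint[symmetric] by (rule nn_integral_cmult) measurable
  also have "\<dots> = ennreal (sqrt 2 ^ p * exp (- t\<^sup>2 / (4 * L)))"
    by (simp add: ennreal_mult[symmetric] mult.commute)
  finally show "measure M ?E \<le> sqrt 2 ^ p * exp (- t\<^sup>2 / (4 * L))"
    by (simp add: emeasure_eq_measure)
qed

section \<open>Expected posterior Hamming distance\<close>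

lemma euclid_dist_triangle: "euclid_dist p x z \<le> euclid_dist p x y + euclid_dist p y z"
  using L2_set_triangle_ineq[of "\<lambda>j. x j - y j" "\<lambda>j. y j - z j" "{..<p}"]
  by (simp add: euclid_dist_def)

lemma separated_clusters:
  assumes s: "euclid_dist p (x s) (m (l s)) \<le> d / 8" and t: "euclid_dist p (x t) (m (l t)) \<le> d / 8"
  shows "l s = l t \<Longrightarrow> euclid_dist p (x s) (x t) \<le> d / 4"
    and "d \<le> euclid_dist p (m (l s)) (m (l t)) \<Longrightarrow> 3 * d / 4 \<le> euclid_dist p (x s) (x t)"
proof -
  have t': "euclid_dist p (m (l t)) (x t) \<le> d / 8" using t by (simp add: euclid_dist_commute)
  show "euclid_dist p (x s) (x t) \<le> d / 4" if "l s = l t"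
    using euclid_dist_triangle[of p "x s" "x t" "m (l s)"] s t' that by simp
  have s': "euclid_dist p (m (l s)) (x s) \<le> d / 8" using s by (simp add: euclid_dist_commute)
  show "3 * d / 4 \<le> euclid_dist p (x s) (x t)" if "d \<le> euclid_dist p (m (l s)) (m (l t))"
    using euclid_dist_triangle[of p "m (l s)" "m (l t)" "x s"] euclid_dist_triangle[of p "x s" "m (l t)" "x t"]
      s' t that by linarith
qed

text \<open>In the first term, one factor \<open>real n\<close> is the largest possible distance and
  the other comes from the union bound over the observations. The second term is the deterministic
  bound off \<open>Bad\<close>.\<close>

lemma expected_posterior_hamming_le:
  assumes M: "prob_space M" and n: "n \<ge> 1" and p: "p \<ge> 1" and \<sigma>: "0 < \<sigma>"
    and U: "is_partition n K U"
    and Cov: "\<And>k. k \<in> {1..K} \<Longrightarrow> positive_definite p (Cov k)"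
    and \<Lambda>: "\<And>k. k \<in> {1..K} \<Longrightarrow> lambda_max (Cov k) \<le> \<Lambda>"
    and gaussian: "\<And>k i. k \<in> {1..K} \<Longrightarrow> i \<in> U k \<Longrightarrow>
      distributed M (PiM {..<p} (\<lambda>_. lborel)) (y i) (\<lambda>x. ennreal (mvn_density p (\<mu> k) (Cov k) x))"
    and d: "0 \<le> d" "\<And>k l. k \<in> {1..K} \<Longrightarrow> l \<in> {1..K} \<Longrightarrow> k \<noteq> l \<Longrightarrow> d \<le> euclid_dist p (\<mu> k) (\<mu> l)"
    and C: "0 < C1" "0 < C2" "0 < \<delta>"
    and r: "AE \<omega> in M. C1 * \<delta> \<le> Min ((\<lambda>i. r (y i \<omega>)) ` {1..n}) \<and> Max ((\<lambda>i. r (y i \<omega>)) ` {1..n}) \<le> C2 * \<delta>"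
  shows "prob_space.expectation M (\<lambda>\<omega>. posterior_expectation n K r p \<sigma> (\<lambda>i. y i \<omega>)
      (\<lambda>V. real (hamming_dist n K V U))) \<le>
    real n * (real n * (sqrt 2 ^ p * exp (- (d\<^sup>2 / (256 * \<Lambda>))))) +
    real K ^ n * (real n * (real n * (C2 / C1)) ^ K * ((1 + real n * exp (- (d\<^sup>2 / (4 * \<sigma>\<^sup>2)))) ^ n - 1))"
    (is "_ \<le> _ + ?b")
proof -
  interpret prob_space M by (rule M)
  define l where "l = block_label K U"
  define f where "f \<omega> = posterior_expectation n K r p \<sigma> (\<lambda>i. y i \<omega>) (\<lambda>V. real (hamming_dist n K V U))" for \<omega>
  define Ev where "Ev i = {\<omega> \<in> space M. d / 8 < euclid_dist p (y i \<omega>) (\<mu> (l i))}" for i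
  define Bad where "Bad = (\<Union>i\<in>{1..n}. Ev i)"
  have l: "l i \<in> {1..K}" "i \<in> U (l i)" if "i \<in> {1..n}" for i
    unfolding l_def using block_label_mem[OF U that] .
  have b: "0 \<le> ?b" using C by simp
  have Ev: "Ev i \<in> sets M" "prob (Ev i) \<le> sqrt 2 ^ p * exp (- (d\<^sup>2 / (256 * \<Lambda>)))" if i: "i \<in> {1..n}" for i
  proof -
    have "0 \<le> d / 8" using d by simp
    note tail = gaussian_tail[OF M Cov[OF l(1)[OF i]] p gaussian[OF l[OF i]] this \<Lambda>[OF l(1)[OF i]]]
    show "Ev i \<in> sets M" unfolding Ev_def by (rule tail(1))
    have "prob (Ev i) \<le> sqrt 2 ^ p * exp (- (d / 8)\<^sup>2 / (4 * \<Lambda>))" unfolding Ev_def by (rule tail(2))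
    then show "prob (Ev i) \<le> sqrt 2 ^ p * exp (- (d\<^sup>2 / (256 * \<Lambda>)))" by (simp add: power_divide)
  qed
  have Bad: "Bad \<in> sets M" unfolding Bad_def using Ev(1) by (intro sets.finite_UN) auto
  have "prob Bad \<le> (\<Sum>i\<in>{1..n}. prob (Ev i))"
    unfolding Bad_def using Ev(1) by (intro finite_measure_subadditive_finite) auto
  also have "\<dots> \<le> (\<Sum>i\<in>{1..n}. sqrt 2 ^ p * exp (- (d\<^sup>2 / (256 * \<Lambda>))))"
    using Ev(2) by (intro sum_mono) auto
  finally have prob_Bad: "prob Bad \<le> real n * (sqrt 2 ^ p * exp (- (d\<^sup>2 / (256 * \<Lambda>))))" by simp
  have dom: "AE \<omega> in M. f \<omega> \<le> real n * indicator Bad \<omega> + ?b"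
    \<comment> \<open>\<open>AE_space\<close> supplies membership in the space, without which
      avoiding \<open>Ev i\<close> says nothing about the distance.\<close>
    using r AE_space
  proof eventually_elim
    case (elim \<omega>)
    have r1: "C1 * \<delta> \<le> r (y i \<omega>)" "r (y i \<omega>) \<le> C2 * \<delta>" if "i \<in> {1..n}" for i
    proof -
      have "Min ((\<lambda>i. r (y i \<omega>)) ` {1..n}) \<le> r (y i \<omega>)" using that by (intro Min_le) auto
      then show "C1 * \<delta> \<le> r (y i \<omega>)" using elim by linarith
      have "r (y i \<omega>) \<le> Max ((\<lambda>i. r (y i \<omega>)) ` {1..n})" using that by (intro Max_ge) auto
      then show "r (y i \<omega>) \<le> C2 * \<delta>" using elim by linarith
    qed
    have C1\<delta>: "0 < C1 * \<delta>" using C by simp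
    have r0: "0 < r (y i \<omega>)" if "i \<in> {1..n}" for i using r1(1)[OF that] C1\<delta> by linarith
    show ?case
    proof (cases "\<omega> \<in> Bad")
      case True
      have "f \<omega> \<le> real n"
        unfolding f_def using hamming_dist_le_n r0 by (intro posterior_expectation_le[OF \<sigma> _ U]) auto
      then show ?thesis using True b by simp
    next
      case False
      have good: "euclid_dist p (y i \<omega>) (\<mu> (l i)) \<le> d / 8" if "i \<in> {1..n}" for i
        using False that elim by (auto simp: Bad_def Ev_def not_less)
      have "f \<omega> \<le> real K ^ n * (real n * (real n * (C2 * \<delta>) / (C1 * \<delta>)) ^ K *
          ((1 + real n * exp (- ((3 * d / 4)\<^sup>2 - (d / 4)\<^sup>2) / (2 * \<sigma>\<^sup>2))) ^ n - 1))"
        unfolding f_def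
      proof (rule posterior_hamming_le[where r = r and y = "\<lambda>i. y i \<omega>", OF U \<sigma> C1\<delta> r1], assumption, assumption)
        fix s t assume st: "s \<in> {1..n}" "t \<in> {1..n}"
        note sep = separated_clusters[of p "\<lambda>i. y i \<omega>" s \<mu> l d t, OF good[OF st(1)] good[OF st(2)]]
        show "euclid_dist p (y s \<omega>) (y t \<omega>) \<le> d / 4" if "block_label K U s = block_label K U t"
          using sep(1) that by (simp add: l_def)
        show "3 * d / 4 \<le> euclid_dist p (y s \<omega>) (y t \<omega>)" if "block_label K U s \<noteq> block_label K U t"
          using sep(2) d(2)[OF l(1)[OF st(1)] l(1)[OF st(2)]] that by (simp add: l_def)
      qed (use d in simp)
      also have "real n * (C2 * \<delta>) / (C1 * \<delta>) = real n * (C2 / C1)" using C by simp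
      also have "- ((3 * d / 4)\<^sup>2 - (d / 4)\<^sup>2) / (2 * \<sigma>\<^sup>2) = - (d\<^sup>2 / (4 * \<sigma>\<^sup>2))"
        using \<sigma> by (simp add: power2_eq_square field_simps)
      finally show ?thesis using False by simp
    qed
  qed
  have int: "integrable M (\<lambda>\<omega>. real n * indicator Bad \<omega> + ?b)"
    by (intro Bochner_Integration.integrable_add integrable_mult_right integrable_const)
       (use Bad in \<open>auto simp: emeasure_eq_measure\<close>)
  have eq: "expectation (\<lambda>\<omega>. real n * indicator Bad \<omega> + ?b) = real n * prob Bad + ?b"
    using Bad by (subst Bochner_Integration.integral_add) (auto simp: prob_space emeasure_eq_measure)
  have "expectation f \<le> real n * prob Bad + ?b"
  proof (cases "integrable M f")
    case True
    then show ?thesis unfolding eq[symmetric] using int dom by (rule integral_mono_AE)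
  next
    case False
    \<comment> \<open>the Bochner integral of a non-integrable function is 0\<close>
    then show ?thesis using b by (simp add: not_integrable_integral_eq)
  qed
  also have "real n * prob Bad \<le> real n * (real n * (sqrt 2 ^ p * exp (- (d\<^sup>2 / (256 * \<Lambda>)))))"
    using prob_Bad by (intro mult_left_mono) auto
  finally show ?thesis by (simp add: f_def[abs_def])
qed

section \<open>Rates\<close>

text \<open>With \<open>a = n * ln (K + 1)\<close>, each of \<open>K ^ n\<close>, \<open>n\<close>,
  \<open>(n * c) ^ K\<close> and a stray factor 2 is at most \<open>exp a\<close>, and
  \<open>n * u\<close> is at most \<open>exp (2 * a - x / 4)\<close>: six \<open>a\<close> in all.
  Since \<open>x \<ge> 48 * a\<close>, these use up \<open>x / 8\<close>; the other
  \<open>x / 8\<close> is at least \<open>6 * s\<^sup>2\<close>. Each of the two terms is at most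
  \<open>exp (- (s\<^sup>2 / 512))\<close>, which explains the 2.\<close>

lemma rate_bound:
  fixes d s \<sigma> \<Lambda> c :: real
  assumes n: "n \<ge> 1" and K: "K \<ge> 2" and \<sigma>: "0 < \<sigma>" and \<Lambda>: "0 < \<Lambda>" and c: "0 \<le> c"
    and cK: "(real n * c) ^ K \<le> exp (real n)"
    and s: "s\<^sup>2 = d\<^sup>2 / \<Lambda>" "10000 * max (real p) (ln (real n)) \<le> s\<^sup>2"
    and \<sigma>1: "48 * \<sigma>\<^sup>2 \<le> d\<^sup>2 / (real n * ln (real K + 1))" and \<sigma>2: "48 * \<sigma>\<^sup>2 \<le> \<Lambda>"
  shows "real n * (real n * (sqrt 2 ^ p * exp (- (d\<^sup>2 / (256 * \<Lambda>))))) +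
    real K ^ n * (real n * (real n * c) ^ K * ((1 + real n * exp (- (d\<^sup>2 / (4 * \<sigma>\<^sup>2)))) ^ n - 1))
    \<le> 2 * exp (- (s\<^sup>2 / 512))"
proof -
  define a where "a = real n * ln (real K + 1)"
  define x where "x = d\<^sup>2 / \<sigma>\<^sup>2"
  define u where "u = real n * exp (- (x / 4))"
  have n': "real n = exp (ln (real n))" using n by simp
  \<comment> \<open>At least two blocks give \<open>K + 1 \<ge> 3\<close>, which exceeds
    \<open>exp 1\<close>, so that \<open>a\<close> dominates \<open>n\<close>.\<close>
  have "exp 1 \<le> real K + 1" using exp_le K by linarith
  then have "1 \<le> ln (real K + 1)" by (subst ln_ge_iff) auto
  then have "real n * 1 \<le> a" unfolding a_def by (intro mult_left_mono) auto
  then have a: "real n \<le> a" "1 \<le> a" using n by auto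
  have n_le: "real n \<le> exp a"
    using exp_ge_add_one_self[of a] a(1) by linarith
  have ax: "48 * a \<le> x"
  proof -
    have "48 * \<sigma>\<^sup>2 \<le> d\<^sup>2 / a" using \<sigma>1 by (simp only: a_def)
    then show ?thesis using a \<sigma> by (simp add: x_def field_simps)
  qed
  have sx: "48 * s\<^sup>2 \<le> x"
  proof -
    have "48 * s\<^sup>2 * \<sigma>\<^sup>2 = s\<^sup>2 * (48 * \<sigma>\<^sup>2)" by simp
    also have "\<dots> \<le> s\<^sup>2 * \<Lambda>" using \<sigma>2 by (intro mult_left_mono) auto
    also have "\<dots> = d\<^sup>2" using s \<Lambda> by simp
    finally show ?thesis using \<sigma> by (simp add: x_def field_simps)
  qed
  have first: "real n * (real n * (sqrt 2 ^ p * exp (- (d\<^sup>2 / (256 * \<Lambda>))))) \<le> exp (- (s\<^sup>2 / 512))"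
  proof -
    have "sqrt 2 \<le> exp 1" using exp_ge_add_one_self[of 1] real_sqrt_le_mono[of 2 4] by simp
    then have "sqrt 2 ^ p \<le> exp 1 ^ p" by (intro power_mono) auto
    also have "\<dots> = exp (real p)" by (simp add: exp_of_nat_mult[symmetric])
    finally have "real n * (real n * (sqrt 2 ^ p * exp (- (d\<^sup>2 / (256 * \<Lambda>))))) \<le>
        exp (ln (real n)) * (exp (ln (real n)) * (exp (real p) * exp (- (d\<^sup>2 / (256 * \<Lambda>)))))"
      using n by (intro mult_mono) auto
    also have "\<dots> = exp (2 * ln (real n) + real p - s\<^sup>2 / 256)"
      by (simp add: s(1) exp_add[symmetric] exp_diff exp_minus field_simps)
    also have "\<dots> \<le> exp (- (s\<^sup>2 / 512))"
    proof -
      have "2 * ln (real n) + real p \<le> 3 * max (real p) (ln (real n))" by linarith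
      then show ?thesis using s(2) zero_le_power2[of s] by simp
    qed
    finally show ?thesis .
  qed
  have nu: "real n * u \<le> exp (2 * a - x / 4)"
  proof -
    have "real n * u \<le> exp a * (exp a * exp (- (x / 4)))"
      unfolding u_def using n_le by (intro mult_mono) auto
    then show ?thesis by (simp add: exp_add[symmetric] algebra_simps)
  qed
  also have "\<dots> \<le> 1" using ax a by simp
  finally have nu1: "real n * u \<le> 1" .
  \<comment> \<open>After subtracting 1 only terms of order \<open>n * u\<close> remain; this is
    where the decay comes from, so the power is expanded to second order.\<close>
  have "(1 + u) ^ n \<le> exp u ^ n" using exp_ge_add_one_self[of u] by (intro power_mono) (auto simp: u_def)
  also have "\<dots> = exp (real n * u)" by (simp add: exp_of_nat_mult)
  also have "\<dots> \<le> 1 + real n * u + (real n * u)\<^sup>2" using nu1 by (intro exp_bound) (auto simp: u_def)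
  also have "(real n * u)\<^sup>2 \<le> real n * u"
    using nu1 mult_left_mono[OF nu1, of "real n * u"] by (simp add: u_def power2_eq_square)
  finally have E: "(1 + u) ^ n - 1 \<le> 2 * exp (2 * a - x / 4)" using nu by linarith
  \<comment> \<open>Trades the factor 2 for one more \<open>exp a\<close>, so that all factors have
    the same form.\<close>
  have "2 \<le> exp a" using exp_ge_add_one_self[of a] a by linarith
  then have "2 * exp (2 * a - x / 4) \<le> exp a * exp (2 * a - x / 4)" by (intro mult_right_mono) auto
  then have E': "(1 + u) ^ n - 1 \<le> exp a * exp (2 * a - x / 4)" using E by linarith
  have Kn: "real K ^ n \<le> exp a"
  proof -
    have "real K ^ n \<le> (real K + 1) ^ n" by (intro power_mono) auto
    also have "\<dots> = exp (ln (real K + 1)) ^ n" by simp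
    also have "\<dots> = exp a" unfolding a_def by (simp only: exp_of_nat_mult)
    finally show ?thesis .
  qed
  have cK': "(real n * c) ^ K \<le> exp a" using cK a(1) by (rule order_trans[OF _ iffD2[OF exp_le_cancel_iff]])
  have "real K ^ n * (real n * (real n * c) ^ K * ((1 + u) ^ n - 1)) \<le>
      exp a * (exp a * exp a * (exp a * exp (2 * a - x / 4)))"
    using Kn n_le cK' E' c by (intro mult_mono) (auto simp: u_def)
  also have "\<dots> = exp (6 * a - x / 4)" by (simp add: exp_add[symmetric])
  also have "\<dots> \<le> exp (- (s\<^sup>2 / 512))" 
  proof -
    have "6 * a - x / 4 \<le> - (s\<^sup>2 / 512)" using ax sx zero_le_power2[of s] by linarith
    then show ?thesis by simp
  qed
  finally have second: "real K ^ n * (real n * (real n * c) ^ K * ((1 + u) ^ n - 1)) \<le> exp (- (s\<^sup>2 / 512))" .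
  have "u = real n * exp (- (d\<^sup>2 / (4 * \<sigma>\<^sup>2)))" by (simp add: u_def x_def mult.commute)
  then show ?thesis using first second by simp
qed

section \<open>From the asymptotic assumptions to a fixed sample size\<close>

text \<open>The logarithm of the left side is at most \<open>sqrt n * ln (n * c)\<close>, which is
  eventually below \<open>n\<close>. This is how (A2) controls the root kernel factors.\<close>

lemma power_block_count_le:
  assumes K: "(\<lambda>n. real (K n)) \<in> o(\<lambda>n. sqrt (real n))" and c: "0 < (c :: real)"
  shows "eventually (\<lambda>n. (real n * c) ^ K n \<le> exp (real n)) sequentially"
proof -
  have "eventually (\<lambda>n. norm (real (K n)) \<le> 1 * norm (sqrt (real n))) sequentially"
    using landau_o.smallD[OF K, of 1] by simp
  moreover have "eventually (\<lambda>n. sqrt (real n) * ln (real n * c) \<le> real n) sequentially"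
    using c by real_asymp
  \<comment> \<open>Makes the logarithm nonnegative, so that \<open>K n\<close> may be replaced by
    the larger \<open>sqrt n\<close> in front of it.\<close>
  moreover have "eventually (\<lambda>n. 1 \<le> real n * c) sequentially"
    using c by real_asymp
  ultimately show ?thesis
  proof eventually_elim
    case (elim n)
    have "(real n * c) ^ K n = exp (real (K n) * ln (real n * c))"
      using elim(3) by (simp add: exp_of_nat_mult)
    also have "\<dots> \<le> exp (sqrt (real n) * ln (real n * c))"
      using elim(1,3) by (simp add: mult_right_mono)
    also have "\<dots> \<le> exp (real n)" using elim(2) by simp
    finally show ?case .
  qed
qed

lemma oracle_partition:
  assumes disj: "disjoint_family_on V0 {1..}" and cover: "(\<Union>j \<in> {1..}. V0 j) = {1..}"
    and lab: "bij_betw (e n) {1..K} (active_blocks V0 n)"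
  shows "is_partition n K (oracle_block V0 e n)"
  unfolding is_partition_def
proof (intro conjI ballI)
  have act: "e n k \<in> active_blocks V0 n" if "k \<in> {1..K}" for k
    using lab that by (auto simp: bij_betw_def)
  show "oracle_block V0 e n k \<noteq> {}" if "k \<in> {1..K}" for k
    using act[OF that] by (auto simp: active_blocks_def oracle_block_def)
  show "disjoint_family_on (oracle_block V0 e n) {1..K}"
    unfolding disjoint_family_on_def
  proof (intro ballI impI)
    fix k l assume kl: "k \<in> {1..K}" "l \<in> {1..K}" "k \<noteq> l"
    then have "e n k \<noteq> e n l" using inj_on_eq_iff[OF bij_betw_imp_inj_on[OF lab]] by blast
    moreover have "e n k \<in> {1..}" "e n l \<in> {1..}" using act[OF kl(1)] act[OF kl(2)] by (simp_all add: active_blocks_def)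
    ultimately have "V0 (e n k) \<inter> V0 (e n l) = {}" using disj unfolding disjoint_family_on_def by blast
    then show "oracle_block V0 e n k \<inter> oracle_block V0 e n l = {}" by (auto simp: oracle_block_def)
  qed
  show "(\<Union>k\<in>{1..K}. oracle_block V0 e n k) = {1..n}"
  proof
    show "{1..n} \<subseteq> (\<Union>k\<in>{1..K}. oracle_block V0 e n k)"
    proof
      fix i assume i: "i \<in> {1..n}"
      then obtain j where j: "j \<in> {1..}" "i \<in> V0 j" using cover by auto
      then have "j \<in> active_blocks V0 n" using i by (auto simp: active_blocks_def)
      then obtain k where "k \<in> {1..K}" "e n k = j" using lab by (metis bij_betw_def imageE)
      then show "i \<in> (\<Union>k\<in>{1..K}. oracle_block V0 e n k)" using i j by (auto simp: oracle_block_def)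
    qed
  qed (auto simp: oracle_block_def)
qed

text \<open>Two blocks make the index set nonempty, so the infimum lies between 0 and one actual
  distance and is finite.\<close>

lemma D_mu_min_real:
  assumes "K \<ge> 2"
  obtains d where "D_mu_min p K \<mu> = ereal d" "0 \<le> d"
    "\<And>k l. k \<in> {1..K} \<Longrightarrow> l \<in> {1..K} \<Longrightarrow> k \<noteq> l \<Longrightarrow> d \<le> euclid_dist p (\<mu> k) (\<mu> l)"
proof -
  let ?S = "{(k, l). k \<in> {1..K} \<and> l \<in> {1..K} \<and> k \<noteq> l}"
  have le: "D_mu_min p K \<mu> \<le> ereal (euclid_dist p (\<mu> k) (\<mu> l))"
    if "k \<in> {1..K}" "l \<in> {1..K}" "k \<noteq> l" for k l
    unfolding D_mu_min_def using that by (intro INF_lower2[of "(k, l)"]) auto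
  have ge: "0 \<le> D_mu_min p K \<mu>"
    unfolding D_mu_min_def by (intro INF_greatest) (auto simp: euclid_dist_nonneg)
  have "D_mu_min p K \<mu> \<le> ereal (euclid_dist p (\<mu> 1) (\<mu> 2))" using assms by (intro le) auto
  then have "D_mu_min p K \<mu> \<noteq> \<infinity>" "D_mu_min p K \<mu> \<noteq> -\<infinity>" using ge by auto
  then obtain d where d: "D_mu_min p K \<mu> = ereal d" by (cases "D_mu_min p K \<mu>") auto
  then show ?thesis using le ge by (intro that[of d]) auto
qed

theorem theorem4p5:
  fixes V0 :: "nat \<Rightarrow> nat set"
    and e :: "nat \<Rightarrow> nat \<Rightarrow> nat"
    and K0 :: "nat \<Rightarrow> nat"
    and p :: "nat \<Rightarrow> nat"
    and \<sigma> \<delta> :: "nat \<Rightarrow> real"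
    and r :: "nat \<Rightarrow> (nat \<Rightarrow> real) \<Rightarrow> real"
    and \<mu> :: "nat \<Rightarrow> nat \<Rightarrow> nat \<Rightarrow> real"
    and Cov :: "nat \<Rightarrow> nat \<Rightarrow> real mat"
    and M :: "nat \<Rightarrow> 'a measure"
    and y :: "nat \<Rightarrow> nat \<Rightarrow> 'a \<Rightarrow> nat \<Rightarrow> real"
    and \<Lambda> :: "nat \<Rightarrow> real"
    and D snr :: "nat \<Rightarrow> ereal"
  assumes oracle_disjoint: "disjoint_family_on V0 {1..}"
    and oracle_cover: "(\<Union>j \<in> {1..}. V0 j) = {1..}"
    and K0_eq: "\<And>n. K0 n = num_blocks V0 n"
    and labelling: "\<And>n. bij_betw (e n) {1..K0 n} (active_blocks V0 n)"
    and p_pos: "\<And>n. n \<ge> 1 \<Longrightarrow> p n \<ge> 1"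
    and sigma_pos: "\<And>n. n \<ge> 1 \<Longrightarrow> \<sigma> n > 0"
    and delta_pos: "\<And>n. n \<ge> 1 \<Longrightarrow> \<delta> n > 0"
    and root_kernel_measurable:
      "\<And>n. n \<ge> 1 \<Longrightarrow> r n \<in> borel_measurable (PiM {..<p n} (\<lambda>_. borel))"
    and root_kernel_pos:
      "\<And>n x. n \<ge> 1 \<Longrightarrow> x \<in> space (PiM {..<p n} (\<lambda>_. borel :: real measure)) \<Longrightarrow> r n x > 0"
    and Cov_pd: "\<And>n k. n \<ge> 1 \<Longrightarrow> k \<in> {1..K0 n} \<Longrightarrow> positive_definite (p n) (Cov n k)"
    and prob: "\<And>n. n \<ge> 1 \<Longrightarrow> prob_space (M n)"
    and indep: "\<And>n. n \<ge> 1 \<Longrightarrow>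
      prob_space.indep_vars (M n) (\<lambda>_. PiM {..<p n} (\<lambda>_. borel)) (y n) {1..n}"
    and gaussian: "\<And>n k i. n \<ge> 1 \<Longrightarrow> k \<in> {1..K0 n} \<Longrightarrow> i \<in> oracle_block V0 e n k \<Longrightarrow>
      distributed (M n) (PiM {..<p n} (\<lambda>_. lborel)) (y n i)
        (\<lambda>x. ennreal (mvn_density (p n) (\<mu> n k) (Cov n k) x))"
    and Lambda_eq: "\<And>n. \<Lambda> n = Lambda_max (K0 n) (Cov n)"
    and D_eq: "\<And>n. D n = D_mu_min (p n) (K0 n) (\<mu> n)"
    and snr_eq: "\<And>n. snr n = SNR (p n) (K0 n) (\<mu> n) (Cov n)"
    and A1: "\<exists>C1 > 0. \<exists>C2 > 0. \<forall>\<^sub>F n in sequentially. AE \<omega> in M n.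
      C1 * \<delta> n \<le> Min ((\<lambda>i. r n (y n i \<omega>)) ` {1..n}) \<and>
      Max ((\<lambda>i. r n (y n i \<omega>)) ` {1..n}) \<le> C2 * \<delta> n"
    and A2: "(\<lambda>n. real (K0 n)) \<in> o(\<lambda>n. sqrt (real n))"
    and A3: "(\<lambda>n. snr n / ereal (sqrt (max (real (p n)) (ln (real n))))) \<longlonglongrightarrow> \<infinity>"
    and A4: "(\<lambda>n. (\<sigma> n)\<^sup>2) \<in> o(\<lambda>n. real_of_ereal
      (min ((D n)\<^sup>2 / ereal (real n * ln (real (K0 n) + 1))) (ereal (\<Lambda> n))))"
  shows "\<exists>c > 0. \<exists>C > 0. \<forall>\<^sub>F n in sequentially.
    prob_space.expectation (M n) (\<lambda>\<omega>.
      posterior_expectation n (K0 n) (r n) (p n) (\<sigma> n) (\<lambda>i. y n i \<omega>)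
        (\<lambda>V. real (hamming_dist n (K0 n) V (oracle_block V0 e n))))
      \<le> C * exp_minus (ereal c * (snr n)\<^sup>2)"
proof -
  obtain C1 C2 where C: "0 < C1" "0 < C2" and A1': "\<forall>\<^sub>F n in sequentially. AE \<omega> in M n.
      C1 * \<delta> n \<le> Min ((\<lambda>i. r n (y n i \<omega>)) ` {1..n}) \<and>
      Max ((\<lambda>i. r n (y n i \<omega>)) ` {1..n}) \<le> C2 * \<delta> n"
    using A1 by blast
  have c: "0 < C2 / C1" using C by simp
  let ?R = "\<lambda>n. real_of_ereal (min ((D n)\<^sup>2 / ereal (real n * ln (real (K0 n) + 1))) (ereal (\<Lambda> n)))"
  \<comment> \<open>The thresholds are dictated by \<open>rate_bound\<close>: 100 becomes 10000
    after squaring, and \<open>1 / 48\<close> below becomes the factor 48.\<close>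
  have A3': "\<forall>\<^sub>F n in sequentially. ereal 100 < snr n / ereal (sqrt (max (real (p n)) (ln (real n))))"
    using A3 unfolding tendsto_PInfty by blast
  have A4': "\<forall>\<^sub>F n in sequentially. norm ((\<sigma> n)\<^sup>2) \<le> 1 / 48 * norm (?R n)"
    using landau_o.smallD[OF A4, of "1 / 48"] by simp
  have "\<forall>\<^sub>F n in sequentially.
    prob_space.expectation (M n) (\<lambda>\<omega>.
      posterior_expectation n (K0 n) (r n) (p n) (\<sigma> n) (\<lambda>i. y n i \<omega>)
        (\<lambda>V. real (hamming_dist n (K0 n) V (oracle_block V0 e n))))
      \<le> 2 * exp_minus (ereal (1 / 512) * (snr n)\<^sup>2)"
    using A1' A3' A4' power_block_count_le[OF A2 c] eventually_ge_at_top[of 1]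
  proof eventually_elim
    case (elim n)
    let ?U = "oracle_block V0 e n" and ?K = "K0 n"
    let ?f = "\<lambda>\<omega>. posterior_expectation n ?K (r n) (p n) (\<sigma> n) (\<lambda>i. y n i \<omega>)
        (\<lambda>V. real (hamming_dist n ?K V ?U))"
    have n: "n \<ge> 1" by fact
    have U: "is_partition n ?K ?U" by (rule oracle_partition[OF oracle_disjoint oracle_cover labelling])
    have K1: "?K \<ge> 1" using block_label_mem(1)[OF U, of 1] n by simp
    have lam: "lambda_max (Cov n k) \<le> \<Lambda> n" if "k \<in> {1..?K}" for k
      unfolding Lambda_eq Lambda_max_def using that by (intro Max_ge) auto
    have "0 < lambda_max (Cov n 1)"
      using K1 n by (intro inverse_quadratic_form_ge(1)[OF Cov_pd p_pos]) auto
    then have \<Lambda>: "0 < \<Lambda> n" using lam[of 1] K1 by simp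
    show ?case
    proof (cases "?K = 1")
      \<comment> \<open>Here SNR is infinite and \<open>exp_minus\<close> gives 0, so the expected
        distance must be exactly 0; it is, since the only block leaves nothing to
        misclassify.\<close>
      case True
      have "D n = \<infinity>"
      proof -
        have "{(k, l). k \<in> {1..?K} \<and> l \<in> {1..?K} \<and> k \<noteq> l} = {}" using True by auto
        then show ?thesis unfolding D_eq D_mu_min_def by (simp only: image_empty Inf_empty top_ereal_def)
      qed
      then have "snr n = \<infinity>"
        using \<Lambda> by (simp add: snr_eq SNR_def D_eq Lambda_eq)
      moreover have "hamming_dist n ?K V ?U = 0" if "V \<in> ordered_partitions n ?K" for V
      proof (rule hamming_dist_refinement[OF _ U])
        fix s t assume "s \<in> {1..n}" "t \<in> {1..n}"
        then show "block_label ?K ?U s = block_label ?K ?U t"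
          using block_label_mem(1)[OF U, of s] block_label_mem(1)[OF U, of t] True by simp
      qed (use that in \<open>simp add: ordered_partitions_eq\<close>)
      then have "?f = (\<lambda>\<omega>. 0)" by (simp add: posterior_expectation_def)
      ultimately show ?thesis by (simp add: exp_minus_def power2_eq_square)
    next
      case False
      then have K2: "?K \<ge> 2" using K1 by simp
      obtain d where d: "D_mu_min (p n) ?K (\<mu> n) = ereal d" "0 \<le> d"
        "\<And>k l. k \<in> {1..?K} \<Longrightarrow> l \<in> {1..?K} \<Longrightarrow> k \<noteq> l \<Longrightarrow> d \<le> euclid_dist (p n) (\<mu> n k) (\<mu> n l)"
        using D_mu_min_real[OF K2] by blast
      define s where "s = d / sqrt (\<Lambda> n)"
      have snr: "snr n = ereal s"
        using \<Lambda> by (simp add: snr_eq SNR_def d s_def Lambda_eq)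
      let ?m = "max (real (p n)) (ln (real n))"
      have m1: "1 \<le> ?m" using p_pos[OF n] by simp
      have s2: "10000 * ?m \<le> s\<^sup>2"
      proof -
        have "100 < s / sqrt ?m" using elim(2) m1 unfolding snr by simp
        then have "100 * sqrt ?m \<le> s" using m1 by (simp add: pos_less_divide_eq)
        then have "(100 * sqrt ?m)\<^sup>2 \<le> s\<^sup>2" using m1 by (intro power_mono) auto
        then show ?thesis using m1 by (simp add: power_mult_distrib)
      qed
      have lnK: "0 < ln (real ?K + 1)" using K2 by simp
      have "?R n = min (d\<^sup>2 / (real n * ln (real ?K + 1))) (\<Lambda> n)"
        using lnK n by (simp add: D_eq d ereal_min[symmetric] del: ereal_min)
      \<comment> \<open>Nonnegativity removes the norm around the right side of
        \<open>A4'\<close>.\<close>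
      moreover have "0 \<le> min (d\<^sup>2 / (real n * ln (real ?K + 1))) (\<Lambda> n)"
        using lnK \<Lambda> by simp
      ultimately have \<sigma>: "48 * (\<sigma> n)\<^sup>2 \<le> min (d\<^sup>2 / (real n * ln (real ?K + 1))) (\<Lambda> n)"
        using elim(3) by simp
      have "prob_space.expectation (M n) ?f \<le>
        real n * (real n * (sqrt 2 ^ p n * exp (- (d\<^sup>2 / (256 * \<Lambda> n))))) +
        real ?K ^ n * (real n * (real n * (C2 / C1)) ^ ?K *
          ((1 + real n * exp (- (d\<^sup>2 / (4 * (\<sigma> n)\<^sup>2)))) ^ n - 1))"
        by (rule expected_posterior_hamming_le[OF prob[OF n] n p_pos[OF n] sigma_pos[OF n] U Cov_pd[OF n] lam
              gaussian[OF n] d(2,3) C delta_pos[OF n] elim(1)])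
      also have "\<dots> \<le> 2 * exp (- (s\<^sup>2 / 512))"
      proof (rule rate_bound[OF n K2 sigma_pos[OF n] \<Lambda> _ elim(4) _ s2])
        show "s\<^sup>2 = d\<^sup>2 / \<Lambda> n" using \<Lambda> by (simp add: s_def power_divide)
      qed (use \<sigma> c in auto)
      also have "exp (- (s\<^sup>2 / 512)) = exp_minus (ereal (1 / 512) * (snr n)\<^sup>2)"
        by (simp add: snr exp_minus_def)
      finally show ?thesis .
    qed
  qed
  then show ?thesis by (intro exI[of _ "1 / 512"] conjI exI[of _ 2]) auto
qed

end
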